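(* Let $\mathcal{M}$ be a (small) strict braided monoidal category whose unit object $I_{\mathcal{M}}$ is null (both initial and terminal), and suppose that $\mathcal{M}$ is generated by an object $x\in\mathrm{ob}(\mathcal{M})$ in the sense that every object of $\mathcal{M}$ is isomorphic to $x^{\oplus n}$ for some non-negative integer $n$. Let $\mathcal{C}$ be a (small) strict left-module over $\mathcal{M}$, let $\mathcal{A}$ be an abelian category and let $T\colon\mathcal{C}\to\mathcal{A}$ be a functor. Then $\deg^x(T)=\deg(T)$, where $\deg(T)$ is the degree of $T$ with respect to all the stabilisers $(s_y,\imath_y)$, $y\in\mathrm{ob}(\mathcal{M})$, of $\mathcal{C}$, and $\deg^x(T)$ is the degree of $T$ with respect to the single stabiliser $(s_x,\imath_x)$.
   Context: A strict left-module over a strict monoidal category $\mathcal{M}$ is a category $\mathcal{C}$ with a functor $\oplus\colon\mathcal{M}\times\mathcal{C}\to\mathcal{C}$ that is strictly unital ($I_{\mathcal{M}}\oplus -=\mathrm{id}_{\mathcal{C}}$) and strictly associative ($y\oplus(z\oplus c)=(y\oplus z)\oplus c$, on objects and morphisms). When $I_{\mathcal{M}}$ is initial, each $y\in\mathrm{ob}(\mathcal{M})$ gives an endofunctor $s_y=y\oplus -\colon\mathcal{C}\to\mathcal{C}$ and a natural transformation $\imath_y\colon\mathrm{id}_{\mathcal{C}}\to s_y$ with components $i_y\oplus\mathrm{id}_c\colon c=I_{\mathcal{M}}\oplus c\to y\oplus c$, where $i_y\colon I_{\mathcal{M}}\to y$ is the unique morphism. Degree: given a small category $\mathcal{C}$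 with a family of endofunctors $s_i$ and natural transformations $\imath_i\colon\mathrm{id}\to s_i$ ($i\in I$), the degree in $\{-1,0,1,\ldots,\infty\}$ of a functor $T\colon\mathcal{C}\to\mathcal{A}$ is defined recursively: $\deg(T)\leq -1$ iff $T=0$; for $d\geq 0$, $\deg(T)\leq d$ iff $\deg(\mathrm{coker}(T\imath_i\colon T\to Ts_i))\leq d-1$ for all $i\in I$; $\deg(T)=\infty$ if $\deg(T)\leq d$ for no finite $d$. *)

theory Defs
  imports "HOL-Algebra.Group" "HOL-Library.Extended_Real"
begin

section \<open>Categories, functors and natural transformations\<close>

text \<open>
  Objects and arrows form sets inside ambient types, so every category below is small relative
  to its types. The values of the operations outside \<open>Ob\<close>, \<open>Arr\<close> and outside composable
  pairs are irrelevant.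
\<close>

record ('o, 'a) cat =
  Ob :: "'o set"
  Arr :: "'a set"
  Dom :: "'a \<Rightarrow> 'o"
  Cod :: "'a \<Rightarrow> 'o"
  Ident :: "'o \<Rightarrow> 'a"
  Comp :: "'a \<Rightarrow> 'a \<Rightarrow> 'a"  (infixr \<open>\<cdot>\<index>\<close> 70)

definition homset :: "('o, 'a, 'z) cat_scheme \<Rightarrow> 'o \<Rightarrow> 'o \<Rightarrow> 'a set" where
  "homset C X Y = {f \<in> Arr C. Dom C f = X \<and> Cod C f = Y}"

locale category =
  fixes C :: "('o, 'a, 'z) cat_scheme"
  assumes Dom_in_Ob: "f \<in> Arr C \<Longrightarrow> Dom C f \<in> Ob C"
    and Cod_in_Ob: "f \<in> Arr C \<Longrightarrow> Cod C f \<in> Ob C"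
    and Ident_in_homset: "X \<in> Ob C \<Longrightarrow> Ident C X \<in> homset C X X"
    and Comp_in_homset:
      "f \<in> homset C X Y \<Longrightarrow> g \<in> homset C Y Z \<Longrightarrow> g \<cdot>\<^bsub>C\<^esub> f \<in> homset C X Z"
    and Ident_left: "f \<in> homset C X Y \<Longrightarrow> Ident C Y \<cdot>\<^bsub>C\<^esub> f = f"
    and Ident_right: "f \<in> homset C X Y \<Longrightarrow> f \<cdot>\<^bsub>C\<^esub> Ident C X = f"
    and Comp_assoc:
      "f \<in> homset C W X \<Longrightarrow> g \<in> homset C X Y \<Longrightarrow> h \<in> homset C Y Z \<Longrightarrow>
        (h \<cdot>\<^bsub>C\<^esub> g) \<cdot>\<^bsub>C\<^esub> f = h \<cdot>\<^bsub>C\<^esub> (g \<cdot>\<^bsub>C\<^esub> f)"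

definition isomorphism :: "('o, 'a, 'z) cat_scheme \<Rightarrow> 'a \<Rightarrow> bool" where
  "isomorphism C f \<longleftrightarrow> f \<in> Arr C \<and>
    (\<exists>g \<in> homset C (Cod C f) (Dom C f).
      g \<cdot>\<^bsub>C\<^esub> f = Ident C (Dom C f) \<and> f \<cdot>\<^bsub>C\<^esub> g = Ident C (Cod C f))"

definition isomorphic :: "('o, 'a, 'z) cat_scheme \<Rightarrow> 'o \<Rightarrow> 'o \<Rightarrow> bool" where
  "isomorphic C X Y \<longleftrightarrow> (\<exists>f \<in> homset C X Y. isomorphism C f)"

definition initial_object :: "('o, 'a, 'z) cat_scheme \<Rightarrow> 'o \<Rightarrow> bool" where
  "initial_object C X \<longleftrightarrow> X \<in> Ob C \<and> (\<forall>Y \<in> Ob C. \<exists>!f. f \<in> homset C X Y)"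

definition terminal_object :: "('o, 'a, 'z) cat_scheme \<Rightarrow> 'o \<Rightarrow> bool" where
  "terminal_object C X \<longleftrightarrow> X \<in> Ob C \<and> (\<forall>Y \<in> Ob C. \<exists>!f. f \<in> homset C Y X)"

definition null_object :: "('o, 'a, 'z) cat_scheme \<Rightarrow> 'o \<Rightarrow> bool" where
  "null_object C X \<longleftrightarrow> initial_object C X \<and> terminal_object C X"

definition monic :: "('o, 'a, 'z) cat_scheme \<Rightarrow> 'a \<Rightarrow> bool" where
  "monic C f \<longleftrightarrow> f \<in> Arr C \<and>
    (\<forall>W. \<forall>g \<in> homset C W (Dom C f). \<forall>h \<in> homset C W (Dom C f).
      f \<cdot>\<^bsub>C\<^esub> g = f \<cdot>\<^bsub>C\<^esub> h \<longrightarrow> g = h)"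

definition epic :: "('o, 'a, 'z) cat_scheme \<Rightarrow> 'a \<Rightarrow> bool" where
  "epic C f \<longleftrightarrow> f \<in> Arr C \<and>
    (\<forall>Z. \<forall>g \<in> homset C (Cod C f) Z. \<forall>h \<in> homset C (Cod C f) Z.
      g \<cdot>\<^bsub>C\<^esub> f = h \<cdot>\<^bsub>C\<^esub> f \<longrightarrow> g = h)"

definition prod_cat ::
  "('o1, 'a1, 'z1) cat_scheme \<Rightarrow> ('o2, 'a2, 'z2) cat_scheme \<Rightarrow> ('o1 \<times> 'o2, 'a1 \<times> 'a2) cat" where
  "prod_cat C D =
    \<lparr>Ob = Ob C \<times> Ob D, Arr = Arr C \<times> Arr D,
     Dom = map_prod (Dom C) (Dom D), Cod = map_prod (Cod C) (Cod D),
     Ident = map_prod (Ident C) (Ident D),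
     Comp = (\<lambda>g f. (fst g \<cdot>\<^bsub>C\<^esub> fst f, snd g \<cdot>\<^bsub>D\<^esub> snd f))\<rparr>"

record ('o1, 'a1, 'o2, 'a2) fctr =
  on_Ob :: "'o1 \<Rightarrow> 'o2"
  on_Arr :: "'a1 \<Rightarrow> 'a2"

locale is_functor =
  src: category C + tgt: category D
  for C :: "('o1, 'a1, 'z1) cat_scheme"
    and D :: "('o2, 'a2, 'z2) cat_scheme"
    and F :: "('o1, 'a1, 'o2, 'a2) fctr" +
  assumes on_Ob_in_Ob: "X \<in> Ob C \<Longrightarrow> on_Ob F X \<in> Ob D"
    and on_Arr_in_homset:
      "f \<in> homset C X Y \<Longrightarrow> on_Arr F f \<in> homset D (on_Ob F X) (on_Ob F Y)"
    and on_Arr_Ident: "X \<in> Ob C \<Longrightarrow> on_Arr F (Ident C X) = Ident D (on_Ob F X)"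
    and on_Arr_Comp:
      "f \<in> homset C X Y \<Longrightarrow> g \<in> homset C Y Z \<Longrightarrow>
        on_Arr F (g \<cdot>\<^bsub>C\<^esub> f) = on_Arr F g \<cdot>\<^bsub>D\<^esub> on_Arr F f"

definition comp_fctr ::
  "('o2, 'a2, 'o3, 'a3) fctr \<Rightarrow> ('o1, 'a1, 'o2, 'a2) fctr \<Rightarrow> ('o1, 'a1, 'o3, 'a3) fctr" where
  "comp_fctr G F = \<lparr>on_Ob = on_Ob G \<circ> on_Ob F, on_Arr = on_Arr G \<circ> on_Arr F\<rparr>"

definition id_fctr :: "('o, 'a, 'o, 'a) fctr" where
  "id_fctr = \<lparr>on_Ob = id, on_Arr = id\<rparr>"

definition swap_fctr :: "('o1 \<times> 'o2, 'a1 \<times> 'a2, 'o2 \<times> 'o1, 'a2 \<times> 'a1) fctr" where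
  "swap_fctr = \<lparr>on_Ob = prod.swap, on_Arr = prod.swap\<rparr>"

locale natural_transformation =
  F: is_functor C D F + G: is_functor C D G
  for C :: "('o1, 'a1, 'z1) cat_scheme"
    and D :: "('o2, 'a2, 'z2) cat_scheme"
    and F :: "('o1, 'a1, 'o2, 'a2) fctr"
    and G :: "('o1, 'a1, 'o2, 'a2) fctr"
    and \<tau> :: "'o1 \<Rightarrow> 'a2" +
  assumes component_in_homset: "X \<in> Ob C \<Longrightarrow> \<tau> X \<in> homset D (on_Ob F X) (on_Ob G X)"
    and naturality:
      "f \<in> homset C X Y \<Longrightarrow> \<tau> Y \<cdot>\<^bsub>D\<^esub> on_Arr F f = on_Arr G f \<cdot>\<^bsub>D\<^esub> \<tau> X"


section \<open>Strict braided monoidal categories and their strict left-modules\<close>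

record ('o, 'a) monoidal_cat = "('o, 'a) cat" +
  Tensor :: "('o \<times> 'o, 'a \<times> 'a, 'o, 'a) fctr"
  Unit :: 'o

record ('o, 'a) braided_cat = "('o, 'a) monoidal_cat" +
  Braiding :: "'o \<times> 'o \<Rightarrow> 'a"

abbreviation tensor_Ob ::
  "('o, 'a, 'z) monoidal_cat_scheme \<Rightarrow> 'o \<Rightarrow> 'o \<Rightarrow> 'o" where
  "tensor_Ob M X Y \<equiv> on_Ob (Tensor M) (X, Y)"

abbreviation tensor_Arr ::
  "('o, 'a, 'z) monoidal_cat_scheme \<Rightarrow> 'a \<Rightarrow> 'a \<Rightarrow> 'a" where
  "tensor_Arr M f g \<equiv> on_Arr (Tensor M) (f, g)"

locale strict_monoidal_category =
  category M + tensor: is_functor "prod_cat M M" M "Tensor M"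
  for M :: "('o, 'a, 'z) monoidal_cat_scheme" +
  assumes Unit_in_Ob: "Unit M \<in> Ob M"
    and Unit_left_Ob: "X \<in> Ob M \<Longrightarrow> tensor_Ob M (Unit M) X = X"
    and Unit_left_Arr: "f \<in> Arr M \<Longrightarrow> tensor_Arr M (Ident M (Unit M)) f = f"
    and Unit_right_Ob: "X \<in> Ob M \<Longrightarrow> tensor_Ob M X (Unit M) = X"
    and Unit_right_Arr: "f \<in> Arr M \<Longrightarrow> tensor_Arr M f (Ident M (Unit M)) = f"
    and tensor_assoc_Ob:
      "X \<in> Ob M \<Longrightarrow> Y \<in> Ob M \<Longrightarrow> Z \<in> Ob M \<Longrightarrow>
        tensor_Ob M X (tensor_Ob M Y Z) = tensor_Ob M (tensor_Ob M X Y) Z"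
    and tensor_assoc_Arr:
      "f \<in> Arr M \<Longrightarrow> g \<in> Arr M \<Longrightarrow> h \<in> Arr M \<Longrightarrow>
        tensor_Arr M f (tensor_Arr M g h) = tensor_Arr M (tensor_Arr M f g) h"

text \<open>
  A braiding on a strict monoidal category: a natural isomorphism with components
  \<open>X \<otimes> Y \<rightarrow> Y \<otimes> X\<close> satisfying the two hexagon identities, in which the associators
  are identities.
\<close>

locale strict_braided_monoidal_category =
  strict_monoidal_category M +
  braiding: natural_transformation "prod_cat M M" M "Tensor M" "comp_fctr (Tensor M) swap_fctr"
    "Braiding M"
  for M :: "('o, 'a, 'z) braided_cat_scheme" +
  assumes Braiding_iso: "X \<in> Ob M \<Longrightarrow> Y \<in> Ob M \<Longrightarrow> isomorphism M (Braiding M (X, Y))"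
    and hexagon_right:
      "X \<in> Ob M \<Longrightarrow> Y \<in> Ob M \<Longrightarrow> Z \<in> Ob M \<Longrightarrow>
        Braiding M (X, tensor_Ob M Y Z) =
          tensor_Arr M (Ident M Y) (Braiding M (X, Z)) \<cdot>\<^bsub>M\<^esub>
          tensor_Arr M (Braiding M (X, Y)) (Ident M Z)"
    and hexagon_left:
      "X \<in> Ob M \<Longrightarrow> Y \<in> Ob M \<Longrightarrow> Z \<in> Ob M \<Longrightarrow>
        Braiding M (tensor_Ob M X Y, Z) =
          tensor_Arr M (Braiding M (X, Z)) (Ident M Y) \<cdot>\<^bsub>M\<^esub>
          tensor_Arr M (Ident M X) (Braiding M (Y, Z))"

primrec tensor_power :: "('o, 'a, 'z) monoidal_cat_scheme \<Rightarrow> 'o \<Rightarrow> nat \<Rightarrow> 'o" where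
  "tensor_power M X 0 = Unit M"
| "tensor_power M X (Suc n) = tensor_Ob M X (tensor_power M X n)"

definition generated_by :: "('o, 'a, 'z) monoidal_cat_scheme \<Rightarrow> 'o \<Rightarrow> bool" where
  "generated_by M X \<longleftrightarrow> X \<in> Ob M \<and> (\<forall>Y \<in> Ob M. \<exists>n. isomorphic M Y (tensor_power M X n))"

locale strict_left_module =
  strict_monoidal_category M + module: category C + action: is_functor "prod_cat M C" C act
  for M :: "('mo, 'ma, 'z) monoidal_cat_scheme"
    and C :: "('co, 'ca, 'y) cat_scheme"
    and act :: "('mo \<times> 'co, 'ma \<times> 'ca, 'co, 'ca) fctr" +
  assumes act_Unit_Ob: "c \<in> Ob C \<Longrightarrow> on_Ob act (Unit M, c) = c"
    and act_Unit_Arr: "f \<in> Arr C \<Longrightarrow> on_Arr act (Ident M (Unit M), f) = f"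
    and act_assoc_Ob:
      "Y \<in> Ob M \<Longrightarrow> Z \<in> Ob M \<Longrightarrow> c \<in> Ob C \<Longrightarrow>
        on_Ob act (Y, on_Ob act (Z, c)) = on_Ob act (tensor_Ob M Y Z, c)"
    and act_assoc_Arr:
      "u \<in> Arr M \<Longrightarrow> v \<in> Arr M \<Longrightarrow> f \<in> Arr C \<Longrightarrow>
        on_Arr act (u, on_Arr act (v, f)) = on_Arr act (tensor_Arr M u v, f)"

definition stab ::
  "('mo, 'ma, 'z) monoidal_cat_scheme \<Rightarrow> ('mo \<times> 'co, 'ma \<times> 'ca, 'co, 'ca) fctr \<Rightarrow>
    'mo \<Rightarrow> ('co, 'ca, 'co, 'ca) fctr" where
  "stab M act y =
    \<lparr>on_Ob = (\<lambda>c. on_Ob act (y, c)), on_Arr = (\<lambda>f. on_Arr act (Ident M y, f))\<rparr>"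

definition from_Unit :: "('mo, 'ma, 'z) monoidal_cat_scheme \<Rightarrow> 'mo \<Rightarrow> 'ma" where
  "from_Unit M y = (THE f. f \<in> homset M (Unit M) y)"

definition stab_trans ::
  "('mo, 'ma, 'z) monoidal_cat_scheme \<Rightarrow> ('co, 'ca, 'y) cat_scheme \<Rightarrow>
    ('mo \<times> 'co, 'ma \<times> 'ca, 'co, 'ca) fctr \<Rightarrow> 'mo \<Rightarrow> 'co \<Rightarrow> 'ca" where
  "stab_trans M C act y c = on_Arr act (from_Unit M y, Ident C c)"


section \<open>Abelian categories\<close>

record ('o, 'a) ab_cat = "('o, 'a) cat" +
  Plus :: "'a \<Rightarrow> 'a \<Rightarrow> 'a"
  Zero :: "'o \<Rightarrow> 'o \<Rightarrow> 'a"

definition hom_group :: "('o, 'a, 'z) ab_cat_scheme \<Rightarrow> 'o \<Rightarrow> 'o \<Rightarrow> 'a monoid" where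
  "hom_group A X Y = \<lparr>carrier = homset A X Y, mult = Plus A, one = Zero A X Y\<rparr>"

definition is_kernel :: "('o, 'a, 'z) ab_cat_scheme \<Rightarrow> 'a \<Rightarrow> 'a \<Rightarrow> bool" where
  "is_kernel A f k \<longleftrightarrow> f \<in> Arr A \<and> k \<in> Arr A \<and> Cod A k = Dom A f \<and>
    f \<cdot>\<^bsub>A\<^esub> k = Zero A (Dom A k) (Cod A f) \<and>
    (\<forall>W \<in> Ob A. \<forall>g \<in> homset A W (Dom A f). f \<cdot>\<^bsub>A\<^esub> g = Zero A W (Cod A f) \<longrightarrow>
      (\<exists>!h. h \<in> homset A W (Dom A k) \<and> k \<cdot>\<^bsub>A\<^esub> h = g))"

definition is_cokernel :: "('o, 'a, 'z) ab_cat_scheme \<Rightarrow> 'a \<Rightarrow> 'a \<Rightarrow> bool" where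
  "is_cokernel A f p \<longleftrightarrow> f \<in> Arr A \<and> p \<in> Arr A \<and> Dom A p = Cod A f \<and>
    p \<cdot>\<^bsub>A\<^esub> f = Zero A (Dom A f) (Cod A p) \<and>
    (\<forall>Z \<in> Ob A. \<forall>g \<in> homset A (Cod A f) Z. g \<cdot>\<^bsub>A\<^esub> f = Zero A (Dom A f) Z \<longrightarrow>
      (\<exists>!h. h \<in> homset A (Cod A p) Z \<and> h \<cdot>\<^bsub>A\<^esub> p = g))"

locale abelian_category =
  category A for A :: "('o, 'a, 'z) ab_cat_scheme" +
  assumes hom_comm_group: "X \<in> Ob A \<Longrightarrow> Y \<in> Ob A \<Longrightarrow> comm_group (hom_group A X Y)"
    and Comp_Plus_right:
      "f \<in> homset A X Y \<Longrightarrow> f' \<in> homset A X Y \<Longrightarrow> g \<in> homset A Y Z \<Longrightarrow>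
        g \<cdot>\<^bsub>A\<^esub> Plus A f f' = Plus A (g \<cdot>\<^bsub>A\<^esub> f) (g \<cdot>\<^bsub>A\<^esub> f')"
    and Comp_Plus_left:
      "f \<in> homset A X Y \<Longrightarrow> g \<in> homset A Y Z \<Longrightarrow> g' \<in> homset A Y Z \<Longrightarrow>
        Plus A g g' \<cdot>\<^bsub>A\<^esub> f = Plus A (g \<cdot>\<^bsub>A\<^esub> f) (g' \<cdot>\<^bsub>A\<^esub> f)"
    and null_object_exists: "\<exists>N. null_object A N"
    and biproduct_exists:
      "X \<in> Ob A \<Longrightarrow> Y \<in> Ob A \<Longrightarrow>
        \<exists>B \<in> Ob A. \<exists>i \<in> homset A X B. \<exists>j \<in> homset A Y B.
          \<exists>p \<in> homset A B X. \<exists>q \<in> homset A B Y.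
            p \<cdot>\<^bsub>A\<^esub> i = Ident A X \<and> q \<cdot>\<^bsub>A\<^esub> j = Ident A Y \<and>
            Plus A (i \<cdot>\<^bsub>A\<^esub> p) (j \<cdot>\<^bsub>A\<^esub> q) = Ident A B"
    and kernel_exists: "f \<in> Arr A \<Longrightarrow> \<exists>k. is_kernel A f k"
    and cokernel_exists: "f \<in> Arr A \<Longrightarrow> \<exists>p. is_cokernel A f p"
    and monic_is_kernel: "monic A k \<Longrightarrow> \<exists>f. is_kernel A f k"
    and epic_is_cokernel: "epic A p \<Longrightarrow> \<exists>f. is_cokernel A f p"


section \<open>Degree of a functor\<close>

definition coker_proj :: "('o, 'a, 'z) ab_cat_scheme \<Rightarrow> 'a \<Rightarrow> 'a" where
  "coker_proj A f = (SOME p. is_cokernel A f p)"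

text \<open>
  The cokernel of a natural transformation \<open>\<tau>\<close> into the functor \<open>G\<close>, formed objectwise from
  chosen cokernels; the action on arrows is the one induced by \<open>G\<close>.
\<close>

definition coker_fctr ::
  "('o1, 'a1, 'z1) cat_scheme \<Rightarrow> ('o2, 'a2, 'z2) ab_cat_scheme \<Rightarrow>
    ('o1, 'a1, 'o2, 'a2) fctr \<Rightarrow> ('o1 \<Rightarrow> 'a2) \<Rightarrow> ('o1, 'a1, 'o2, 'a2) fctr" where
  "coker_fctr C A G \<tau> =
    \<lparr>on_Ob = (\<lambda>c. Cod A (coker_proj A (\<tau> c))),
     on_Arr = (\<lambda>f. THE h.
       h \<in> homset A (Cod A (coker_proj A (\<tau> (Dom C f)))) (Cod A (coker_proj A (\<tau> (Cod C f)))) \<and>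
       h \<cdot>\<^bsub>A\<^esub> coker_proj A (\<tau> (Dom C f)) = coker_proj A (\<tau> (Cod C f)) \<cdot>\<^bsub>A\<^esub> on_Arr G f)\<rparr>"

text \<open>Since cokernels are only determined up to isomorphism, so is the condition \<open>T = 0\<close>.\<close>

definition zero_fctr ::
  "('o1, 'a1, 'z1) cat_scheme \<Rightarrow> ('o2, 'a2, 'z2) ab_cat_scheme \<Rightarrow>
    ('o1, 'a1, 'o2, 'a2) fctr \<Rightarrow> bool" where
  "zero_fctr C A T \<longleftrightarrow> (\<forall>c \<in> Ob C. null_object A (on_Ob T c))"

text \<open>
  \<open>degree_lt C A I s \<iota> n T\<close> is the recursively defined condition \<open>deg T \<le> n - 1\<close>, the
  bound being shifted by one so that the recursion runs over the natural numbers and starts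
  at \<open>deg T \<le> -1\<close>.
\<close>

primrec degree_lt ::
  "('o1, 'a1, 'z1) cat_scheme \<Rightarrow> ('o2, 'a2, 'z2) ab_cat_scheme \<Rightarrow> 'i set \<Rightarrow>
    ('i \<Rightarrow> ('o1, 'a1, 'o1, 'a1) fctr) \<Rightarrow> ('i \<Rightarrow> 'o1 \<Rightarrow> 'a1) \<Rightarrow>
    nat \<Rightarrow> ('o1, 'a1, 'o2, 'a2) fctr \<Rightarrow> bool" where
  "degree_lt C A I s \<iota> 0 T \<longleftrightarrow> zero_fctr C A T"
| "degree_lt C A I s \<iota> (Suc n) T \<longleftrightarrow>
    (\<forall>i \<in> I. degree_lt C A I s \<iota> n (coker_fctr C A (comp_fctr T (s i)) (\<lambda>c. on_Arr T (\<iota> i c))))"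

text \<open>The infimum of the empty set is \<open>\<infinity>\<close>.\<close>

definition degree ::
  "('o1, 'a1, 'z1) cat_scheme \<Rightarrow> ('o2, 'a2, 'z2) ab_cat_scheme \<Rightarrow> 'i set \<Rightarrow>
    ('i \<Rightarrow> ('o1, 'a1, 'o1, 'a1) fctr) \<Rightarrow> ('i \<Rightarrow> 'o1 \<Rightarrow> 'a1) \<Rightarrow>
    ('o1, 'a1, 'o2, 'a2) fctr \<Rightarrow> ereal" where
  "degree C A I s \<iota> T = Inf {ereal (real n - 1) | n. degree_lt C A I s \<iota> n T}"


section \<open>Well-definedness\<close>

text \<open>
  The stabilisers are natural transformations, objectwise cokernels are functors, and the degree
  is bounded by \<open>n - 1\<close> exactly when the recursive condition \<open>degree_lt\<close> holds for \<open>n\<close>.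
\<close>

lemma (in category) homset_Ob:
  assumes "f \<in> homset C X Y" shows "X \<in> Ob C" "Y \<in> Ob C"
  using assms Dom_in_Ob Cod_in_Ob by (auto simp: homset_def)

lemma is_functor_comp_fctr:
  assumes "is_functor C D F" "is_functor D E G"
  shows "is_functor C E (comp_fctr G F)"
proof -
  interpret F: is_functor C D F by fact
  interpret G: is_functor D E G by fact
  show ?thesis
  proof unfold_locales
    fix f X Y g Z assume f: "f \<in> homset C X Y" and g: "g \<in> homset C Y Z"
    show "on_Arr (comp_fctr G F) (g \<cdot>\<^bsub>C\<^esub> f) = on_Arr (comp_fctr G F) g \<cdot>\<^bsub>E\<^esub> on_Arr (comp_fctr G F) f"
      using G.on_Arr_Comp[OF F.on_Arr_in_homset[OF f] F.on_Arr_in_homset[OF g]] F.on_Arr_Comp[OF f g]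
      by (simp add: comp_fctr_def)
  qed (auto simp: comp_fctr_def F.on_Ob_in_Ob G.on_Ob_in_Ob F.on_Arr_Ident G.on_Arr_Ident
        intro: F.on_Arr_in_homset G.on_Arr_in_homset)
qed

lemma natural_transformation_whisker:
  assumes "natural_transformation C C id_fctr s \<iota>" "is_functor C A T"
  shows "natural_transformation C A T (comp_fctr T s) (\<lambda>c. on_Arr T (\<iota> c))"
proof -
  interpret n: natural_transformation C C id_fctr s \<iota> by fact
  interpret T: is_functor C A T by fact
  interpret Ts: is_functor C A "comp_fctr T s"
    by (rule is_functor_comp_fctr[OF n.G.is_functor_axioms assms(2)])
  show ?thesis
  proof unfold_locales
    fix X assume "X \<in> Ob C"
    then show "on_Arr T (\<iota> X) \<in> homset A (on_Ob T X) (on_Ob (comp_fctr T s) X)"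
      using n.component_in_homset T.on_Arr_in_homset by (force simp: comp_fctr_def id_fctr_def)
  next
    fix f X Y assume f: "f \<in> homset C X Y"
    note XY = n.F.src.homset_Ob[OF f]
    have i: "\<iota> X \<in> homset C X (on_Ob s X)" "\<iota> Y \<in> homset C Y (on_Ob s Y)"
      using XY n.component_in_homset by (auto simp: id_fctr_def)
    show "on_Arr T (\<iota> Y) \<cdot>\<^bsub>A\<^esub> on_Arr T f = on_Arr (comp_fctr T s) f \<cdot>\<^bsub>A\<^esub> on_Arr T (\<iota> X)"
      using n.naturality[OF f] T.on_Arr_Comp[OF f i(2)]
        T.on_Arr_Comp[OF i(1) n.G.on_Arr_in_homset[OF f]]
      by (simp add: comp_fctr_def id_fctr_def)
  qed
qed

context abelian_category begin

lemma Zero_in_homset: "X \<in> Ob A \<Longrightarrow> Y \<in> Ob A \<Longrightarrow> Zero A X Y \<in> homset A X Y"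
  using monoid.one_closed[OF group.is_monoid[OF comm_group.axioms(2)[OF hom_comm_group]]]
  by (simp add: hom_group_def)

lemma Comp_Zero_right:
  assumes X: "X \<in> Ob A" and g: "g \<in> homset A Y Z"
  shows "g \<cdot>\<^bsub>A\<^esub> Zero A X Y = Zero A X Z"
proof -
  note YZ = homset_Ob[OF g]
  interpret XY: comm_group "hom_group A X Y" using X YZ hom_comm_group by blast
  interpret XZ: comm_group "hom_group A X Z" using X YZ hom_comm_group by blast
  let ?z = "Zero A X Y"
  have z: "?z \<in> homset A X Y" using X YZ Zero_in_homset by blast
  have "Plus A ?z ?z = ?z" using XY.l_one[of ?z] z by (simp add: hom_group_def)
  then have e: "Plus A (g \<cdot>\<^bsub>A\<^esub> ?z) (g \<cdot>\<^bsub>A\<^esub> ?z) = g \<cdot>\<^bsub>A\<^esub> ?z"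
    using Comp_Plus_right[OF z z g] by simp
  have "g \<cdot>\<^bsub>A\<^esub> ?z \<in> carrier (hom_group A X Z)"
    using Comp_in_homset[OF z g] by (simp add: hom_group_def)
  then show ?thesis using XZ.l_cancel_one[of "g \<cdot>\<^bsub>A\<^esub> ?z" "g \<cdot>\<^bsub>A\<^esub> ?z"] e by (simp add: hom_group_def)
qed

lemma Comp_Zero_left:
  assumes Z: "Z \<in> Ob A" and f: "f \<in> homset A X Y"
  shows "Zero A Y Z \<cdot>\<^bsub>A\<^esub> f = Zero A X Z"
proof -
  note XY = homset_Ob[OF f]
  interpret YZ: comm_group "hom_group A Y Z" using Z XY hom_comm_group by blast
  interpret XZ: comm_group "hom_group A X Z" using Z XY hom_comm_group by blast
  let ?z = "Zero A Y Z"
  have z: "?z \<in> homset A Y Z" using Z XY Zero_in_homset by blast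
  have "Plus A ?z ?z = ?z" using YZ.l_one[of ?z] z by (simp add: hom_group_def)
  then have e: "Plus A (?z \<cdot>\<^bsub>A\<^esub> f) (?z \<cdot>\<^bsub>A\<^esub> f) = ?z \<cdot>\<^bsub>A\<^esub> f"
    using Comp_Plus_left[OF f z z] by simp
  have "?z \<cdot>\<^bsub>A\<^esub> f \<in> carrier (hom_group A X Z)"
    using Comp_in_homset[OF f z] by (simp add: hom_group_def)
  then show ?thesis using XZ.l_cancel_one[of "?z \<cdot>\<^bsub>A\<^esub> f" "?z \<cdot>\<^bsub>A\<^esub> f"] e by (simp add: hom_group_def)
qed

lemma is_cokernel_coker_proj: "f \<in> Arr A \<Longrightarrow> is_cokernel A f (coker_proj A f)"
  unfolding coker_proj_def using cokernel_exists by (rule someI_ex)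

lemma coker_proj_in_homset:
  "f \<in> homset A X Y \<Longrightarrow> coker_proj A f \<in> homset A Y (Cod A (coker_proj A f))"
  using is_cokernel_coker_proj[of f] by (simp add: is_cokernel_def homset_def)

lemma coker_proj_Comp:
  "f \<in> homset A X Y \<Longrightarrow> coker_proj A f \<cdot>\<^bsub>A\<^esub> f = Zero A X (Cod A (coker_proj A f))"
  using is_cokernel_coker_proj[of f] by (simp add: is_cokernel_def homset_def)

lemma coker_proj_universal:
  assumes "f \<in> homset A X Y" "g \<in> homset A Y Z" "g \<cdot>\<^bsub>A\<^esub> f = Zero A X Z"
  shows "\<exists>!h. h \<in> homset A (Cod A (coker_proj A f)) Z \<and> h \<cdot>\<^bsub>A\<^esub> coker_proj A f = g"
  using is_cokernel_coker_proj[of f] assms homset_Ob[OF assms(2)]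
  by (simp add: is_cokernel_def homset_def)

lemma coker_proj_cancel:
  assumes f: "f \<in> homset A X Y" and h: "h \<in> homset A (Cod A (coker_proj A f)) Z"
    and k: "k \<in> homset A (Cod A (coker_proj A f)) Z"
    and eq: "h \<cdot>\<^bsub>A\<^esub> coker_proj A f = k \<cdot>\<^bsub>A\<^esub> coker_proj A f"
  shows "h = k"
proof -
  note p = coker_proj_in_homset[OF f]
  have "(k \<cdot>\<^bsub>A\<^esub> coker_proj A f) \<cdot>\<^bsub>A\<^esub> f = Zero A X Z"
    using Comp_assoc[OF f p k] coker_proj_Comp[OF f] Comp_Zero_right homset_Ob[OF f] k by simp
  from coker_proj_universal[OF f Comp_in_homset[OF p k] this] show ?thesis using h k eq by blast
qed

lemma null_object_coker:
  assumes f: "f \<in> homset A X Y" and Y: "null_object A Y"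
  shows "null_object A (Cod A (coker_proj A f))"
proof -
  let ?p = "coker_proj A f" let ?Q = "Cod A ?p"
  note p = coker_proj_in_homset[OF f]
  have Q: "?Q \<in> Ob A" using homset_Ob[OF p] by simp
  have YO: "Y \<in> Ob A" using homset_Ob[OF p] by simp
  have ini: "\<And>Z. Z \<in> Ob A \<Longrightarrow> \<exists>!f. f \<in> homset A Y Z" and ter: "\<And>Z. Z \<in> Ob A \<Longrightarrow> \<exists>!f. f \<in> homset A Z Y"
    using Y by (auto simp: null_object_def initial_object_def terminal_object_def)
  obtain q where q: "q \<in> homset A ?Q Y" using ter[OF Q] by blast
  have qp: "q \<cdot>\<^bsub>A\<^esub> ?p = Ident A Y"
    using ini[OF YO] Comp_in_homset[OF p q] Ident_in_homset[OF YO] by blast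
  have "(?p \<cdot>\<^bsub>A\<^esub> q) \<cdot>\<^bsub>A\<^esub> ?p = Ident A ?Q \<cdot>\<^bsub>A\<^esub> ?p"
    using Comp_assoc[OF p q p] qp Ident_right[OF p] Ident_left[OF p] by simp
  from coker_proj_cancel[OF f Comp_in_homset[OF q p] Ident_in_homset[OF Q] this]
  have pq: "?p \<cdot>\<^bsub>A\<^esub> q = Ident A ?Q" .
  have "\<exists>!h. h \<in> homset A ?Q Z" if Z: "Z \<in> Ob A" for Z
  proof -
    have "h = h'" if h: "h \<in> homset A ?Q Z" "h' \<in> homset A ?Q Z" for h h'
      using coker_proj_cancel[OF f h] ini[OF Z] Comp_in_homset[OF p h(1)] Comp_in_homset[OF p h(2)]
      by blast
    then show ?thesis using ini[OF Z] Comp_in_homset[OF q] by blast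
  qed
  moreover have "\<exists>!h. h \<in> homset A Z ?Q" if Z: "Z \<in> Ob A" for Z
  proof -
    have "h = ?p \<cdot>\<^bsub>A\<^esub> (q \<cdot>\<^bsub>A\<^esub> h)" if h: "h \<in> homset A Z ?Q" for h
      using Comp_assoc[OF h q p] pq Ident_left[OF h] by simp
    then have "h = h'" if "h \<in> homset A Z ?Q" "h' \<in> homset A Z ?Q" for h h'
      using that ter[OF Z] Comp_in_homset[OF that(1) q] Comp_in_homset[OF that(2) q] by metis
    moreover obtain t where "t \<in> homset A Z Y" using ter[OF Z] by blast
    then have "?p \<cdot>\<^bsub>A\<^esub> t \<in> homset A Z ?Q" using p by (rule Comp_in_homset)
    ultimately show ?thesis by blast
  qed
  ultimately show ?thesis using Q by (auto simp: null_object_def initial_object_def terminal_object_def)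
qed

end

lemma coker_fctr_on_Arr:
  assumes "abelian_category A" "natural_transformation C A F G \<tau>" "f \<in> homset C X Y"
  defines "Q \<equiv> coker_fctr C A G \<tau>"
  shows "on_Arr Q f \<in> homset A (on_Ob Q X) (on_Ob Q Y)"
    and "on_Arr Q f \<cdot>\<^bsub>A\<^esub> coker_proj A (\<tau> X) = coker_proj A (\<tau> Y) \<cdot>\<^bsub>A\<^esub> on_Arr G f"
proof -
  interpret A: abelian_category A by fact
  interpret n: natural_transformation C A F G \<tau> by fact
  note f = assms(3)
  note XY = n.F.src.homset_Ob[OF f]
  note tX = n.component_in_homset[OF XY(1)] and tY = n.component_in_homset[OF XY(2)]
  note Gf = n.G.on_Arr_in_homset[OF f] and Ff = n.F.on_Arr_in_homset[OF f]
  note pY = A.coker_proj_in_homset[OF tY]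
  have "(coker_proj A (\<tau> Y) \<cdot>\<^bsub>A\<^esub> on_Arr G f) \<cdot>\<^bsub>A\<^esub> \<tau> X = coker_proj A (\<tau> Y) \<cdot>\<^bsub>A\<^esub> (\<tau> Y \<cdot>\<^bsub>A\<^esub> on_Arr F f)"
    using A.Comp_assoc[OF tX Gf pY] n.naturality[OF f] by simp
  also have "\<dots> = Zero A (on_Ob F X) (Cod A (coker_proj A (\<tau> Y)))"
    using A.Comp_assoc[OF Ff tY pY] A.coker_proj_Comp[OF tY] A.Comp_Zero_left[OF _ Ff]
      A.homset_Ob[OF pY] by simp
  finally have ex1: "\<exists>!h. h \<in> homset A (Cod A (coker_proj A (\<tau> X))) (Cod A (coker_proj A (\<tau> Y))) \<and>
      h \<cdot>\<^bsub>A\<^esub> coker_proj A (\<tau> X) = coker_proj A (\<tau> Y) \<cdot>\<^bsub>A\<^esub> on_Arr G f"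
    by (rule A.coker_proj_universal[OF tX A.Comp_in_homset[OF Gf pY]])
  have "Dom C f = X" "Cod C f = Y" using f by (auto simp: homset_def)
  then show "on_Arr Q f \<in> homset A (on_Ob Q X) (on_Ob Q Y)"
    "on_Arr Q f \<cdot>\<^bsub>A\<^esub> coker_proj A (\<tau> X) = coker_proj A (\<tau> Y) \<cdot>\<^bsub>A\<^esub> on_Arr G f"
    using theI'[OF ex1] by (simp_all add: Q_def coker_fctr_def)
qed

lemma is_functor_coker_fctr:
  assumes "abelian_category A" "natural_transformation C A F G \<tau>"
  shows "is_functor C A (coker_fctr C A G \<tau>)"
proof -
  interpret A: abelian_category A by fact
  interpret n: natural_transformation C A F G \<tau> by fact
  let ?Q = "coker_fctr C A G \<tau>"
  let ?p = "\<lambda>X. coker_proj A (\<tau> X)"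
  have Q: "on_Ob ?Q X = Cod A (?p X)" for X by (simp add: coker_fctr_def)
  note QA = coker_fctr_on_Arr[OF assms, unfolded Q]
  have p: "?p X \<in> homset A (on_Ob G X) (Cod A (?p X))" if "X \<in> Ob C" for X
    using A.coker_proj_in_homset n.component_in_homset that by blast
  show ?thesis
  proof unfold_locales
    fix X assume X: "X \<in> Ob C"
    show QX: "on_Ob ?Q X \<in> Ob A" using A.homset_Ob[OF p[OF X]] Q by simp
    note i = n.F.src.Ident_in_homset[OF X]
    show "on_Arr ?Q (Ident C X) = Ident A (on_Ob ?Q X)"
      unfolding Q
      using A.coker_proj_cancel[OF n.component_in_homset[OF X] QA(1)[OF i]
        A.Ident_in_homset[OF QX[unfolded Q]]] QA(2)[OF i] n.G.on_Arr_Ident[OF X]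
        A.Ident_left[OF p[OF X]] A.Ident_right[OF p[OF X]] by simp
  next
    fix f X Y assume "f \<in> homset C X Y"
    then show "on_Arr ?Q f \<in> homset A (on_Ob ?Q X) (on_Ob ?Q Y)" using QA(1) Q by simp
  next
    fix f X Y g Z assume f: "f \<in> homset C X Y" and g: "g \<in> homset C Y Z"
    note X = n.F.src.homset_Ob(1)[OF f] and Y = n.F.src.homset_Ob(2)[OF f]
      and Z = n.F.src.homset_Ob(2)[OF g]
    note gf = n.F.src.Comp_in_homset[OF f g]
    note Gf = n.G.on_Arr_in_homset[OF f] and Gg = n.G.on_Arr_in_homset[OF g]
    have "(on_Arr ?Q g \<cdot>\<^bsub>A\<^esub> on_Arr ?Q f) \<cdot>\<^bsub>A\<^esub> ?p X = on_Arr ?Q g \<cdot>\<^bsub>A\<^esub> (?p Y \<cdot>\<^bsub>A\<^esub> on_Arr G f)"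
      using A.Comp_assoc[OF p[OF X] QA(1)[OF f] QA(1)[OF g]] QA(2)[OF f] by simp
    also have "\<dots> = (?p Z \<cdot>\<^bsub>A\<^esub> on_Arr G g) \<cdot>\<^bsub>A\<^esub> on_Arr G f"
      using A.Comp_assoc[OF Gf p[OF Y] QA(1)[OF g]] QA(2)[OF g] by simp
    also have "\<dots> = on_Arr ?Q (g \<cdot>\<^bsub>C\<^esub> f) \<cdot>\<^bsub>A\<^esub> ?p X"
      using A.Comp_assoc[OF Gf Gg p[OF Z]] QA(2)[OF gf] n.G.on_Arr_Comp[OF f g] by simp
    finally show "on_Arr ?Q (g \<cdot>\<^bsub>C\<^esub> f) = on_Arr ?Q g \<cdot>\<^bsub>A\<^esub> on_Arr ?Q f"
      using A.coker_proj_cancel[OF n.component_in_homset[OF X] QA(1)[OF gf]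
        A.Comp_in_homset[OF QA(1)[OF f] QA(1)[OF g]]] by simp
  qed
qed

lemma degree_lt_Suc:
  assumes A: "abelian_category A"
    and s: "\<And>i. i \<in> I \<Longrightarrow> natural_transformation C C id_fctr (s i) (\<iota> i)"
    and T: "is_functor C A T" and "degree_lt C A I s \<iota> n T"
  shows "degree_lt C A I s \<iota> (Suc n) T"
  using T assms(4)
proof (induction n arbitrary: T)
  case 0
  have "null_object A (Cod A (coker_proj A (on_Arr T (\<iota> i c))))" if "i \<in> I" "c \<in> Ob C" for i c
  proof -
    interpret n: natural_transformation C C id_fctr "s i" "\<iota> i" using s that by blast
    interpret w: natural_transformation C A T "comp_fctr T (s i)" "\<lambda>c. on_Arr T (\<iota> i c)"
      using natural_transformation_whisker[OF s[OF that(1)] 0(1)] .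
    show ?thesis
      using abelian_category.null_object_coker[OF A w.component_in_homset[OF that(2)]]
        0(2) n.G.on_Ob_in_Ob[OF that(2)] by (simp add: zero_fctr_def comp_fctr_def)
  qed
  then show ?case by (simp add: zero_fctr_def coker_fctr_def)
next
  case (Suc n)
  let ?Q = "\<lambda>i. coker_fctr C A (comp_fctr T (s i)) (\<lambda>c. on_Arr T (\<iota> i c))"
  have "degree_lt C A I s \<iota> (Suc n) (?Q i)" if i: "i \<in> I" for i
  proof (rule Suc.IH)
    show "is_functor C A (?Q i)"
      by (rule is_functor_coker_fctr[OF A natural_transformation_whisker[OF s[OF i] Suc.prems(1)]])
    show "degree_lt C A I s \<iota> n (?Q i)" using Suc.prems(2) i by simp
  qed
  then show ?case by (subst degree_lt.simps(2)) blast
qed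

lemma degree_le_iff:
  assumes A: "abelian_category A"
    and s: "\<And>i. i \<in> I \<Longrightarrow> natural_transformation C C id_fctr (s i) (\<iota> i)"
    and T: "is_functor C A T"
  shows "degree C A I s \<iota> T \<le> ereal (real n - 1) \<longleftrightarrow> degree_lt C A I s \<iota> n T"
proof
  let ?P = "\<lambda>n. degree_lt C A I s \<iota> n T"
  assume "degree C A I s \<iota> T \<le> ereal (real n - 1)"
  then have "degree C A I s \<iota> T < ereal (real n)"
    by (rule le_less_trans) simp
  then obtain m where m: "?P m" "real m - 1 < real n"
    unfolding degree_def Inf_less_iff by auto
  then have "m \<le> n" by linarith
  then show "?P n"
  proof (induction rule: dec_induct)
    case base
    show ?case by (rule m(1))
  next
    case (step k)
    show ?case by (rule degree_lt_Suc[OF A s T step.IH])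
  qed
next
  assume "degree_lt C A I s \<iota> n T"
  then show "degree C A I s \<iota> T \<le> ereal (real n - 1)"
    unfolding degree_def by (intro Inf_lower) blast
qed

lemma stab_natural:
  assumes m: "strict_left_module M C act" and I: "initial_object M (Unit M)" and y: "y \<in> Ob M"
  shows "natural_transformation C C id_fctr (stab M act y) (stab_trans M C act y)"
proof -
  interpret m: strict_left_module M C act by fact
  have h: "(u, f) \<in> homset (prod_cat M C) (a, b) (c, d) \<longleftrightarrow> u \<in> homset M a c \<and> f \<in> homset C b d" for u f a b c d
    by (auto simp: homset_def prod_cat_def)
  note funct = m.action.on_Arr_in_homset[OF iffD2[OF h], simplified]
  have comp: "on_Arr act (v, g) \<cdot>\<^bsub>C\<^esub> on_Arr act (u, f) = on_Arr act (v \<cdot>\<^bsub>M\<^esub> u, g \<cdot>\<^bsub>C\<^esub> f)"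
    if "u \<in> homset M a b" "v \<in> homset M b c" "f \<in> homset C a' b'" "g \<in> homset C b' c'" for u v f g a b c a' b' c'
    using m.action.on_Arr_Comp[of "(u,f)" "(a,a')" "(b,b')" "(v,g)" "(c,c')"] that
    by (simp add: h) (simp add: prod_cat_def)
  have i: "from_Unit M y \<in> homset M (Unit M) y"
    using theI'[of "\<lambda>f. f \<in> homset M (Unit M) y"] I y
    unfolding from_Unit_def initial_object_def by blast
  note idy = m.Ident_in_homset[OF y] and idI = m.Ident_in_homset[OF m.Unit_in_Ob]
  interpret i: is_functor C C id_fctr by unfold_locales (auto simp: id_fctr_def)
  interpret s: is_functor C C "stab M act y"
  proof unfold_locales
    fix X assume "X \<in> Ob C"
    then show "on_Ob (stab M act y) X \<in> Ob C"
      "on_Arr (stab M act y) (Ident C X) = Ident C (on_Ob (stab M act y) X)"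
      using m.action.on_Ob_in_Ob[of "(y,X)"] m.action.on_Arr_Ident[of "(y,X)"] y
      by (auto simp: stab_def prod_cat_def)
  next
    fix f X Y assume "f \<in> homset C X Y"
    then show "on_Arr (stab M act y) f \<in> homset C (on_Ob (stab M act y) X) (on_Ob (stab M act y) Y)"
      using funct idy by (simp add: stab_def)
  next
    fix f X Y g Z assume "f \<in> homset C X Y" "g \<in> homset C Y Z"
    then show "on_Arr (stab M act y) (g \<cdot>\<^bsub>C\<^esub> f) = on_Arr (stab M act y) g \<cdot>\<^bsub>C\<^esub> on_Arr (stab M act y) f"
      using comp[OF idy idy] m.Ident_left[OF idy] by (simp add: stab_def)
  qed
  show ?thesis
  proof unfold_locales
    fix X assume X: "X \<in> Ob C"
    then show "stab_trans M C act y X \<in> homset C (on_Ob id_fctr X) (on_Ob (stab M act y) X)"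
      using funct[of "from_Unit M y" "Unit M" y "Ident C X" X X] i m.module.Ident_in_homset[OF X]
        m.act_Unit_Ob[OF X] by (simp add: id_fctr_def stab_def stab_trans_def)
  next
    fix f X Y assume f: "f \<in> homset C X Y"
    note XY = m.module.homset_Ob[OF f]
    have fA: "f = on_Arr act (Ident M (Unit M), f)" using m.act_Unit_Arr f by (simp add: homset_def)
    have "on_Arr act (from_Unit M y, Ident C Y) \<cdot>\<^bsub>C\<^esub> f = on_Arr act (from_Unit M y, f)"
      using comp[OF idI i f m.module.Ident_in_homset[OF XY(2)]] fA
        m.Ident_right[OF i] m.module.Ident_left[OF f] by simp
    also have "\<dots> = on_Arr act (Ident M y, f) \<cdot>\<^bsub>C\<^esub> on_Arr act (from_Unit M y, Ident C X)"
      using comp[OF i idy m.module.Ident_in_homset[OF XY(1)] f]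
        m.Ident_left[OF i] m.module.Ident_right[OF f] by simp
    finally show "stab_trans M C act y Y \<cdot>\<^bsub>C\<^esub> on_Arr id_fctr f = on_Arr (stab M act y) f \<cdot>\<^bsub>C\<^esub> stab_trans M C act y X"
      by (simp add: id_fctr_def stab_def stab_trans_def)
  qed
qed

end

theory Submission
  imports Defs
begin

text \<open>
  Write \<open>\<Delta>\<^sub>y T\<close> for the cokernel of \<open>T \<rightarrow> T s\<^sub>y\<close>. The functors of degree at most \<open>d\<close>
  are closed under objectwise epimorphic images and, since \<open>\<Delta>\<^sub>y\<close> is right exact, under
  extensions in the sense of right exact sequences. The braiding identifies \<open>(\<Delta>\<^sub>x T) s\<^sub>z\<close> with
  \<open>\<Delta>\<^sub>x (T s\<^sub>z)\<close>, so precomposition with \<open>s\<^sub>z\<close> does not raise the degree with respect to \<open>x\<close>.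
  As \<open>T \<rightarrow> T s\<^bsub>x \<oplus> z\<^esub>\<close> factors through \<open>T s\<^sub>z\<close>, there is a right exact sequence
  \<open>\<Delta>\<^sub>z T \<rightarrow> \<Delta>\<^bsub>x \<oplus> z\<^esub> T \<rightarrow> (\<Delta>\<^sub>x T) s\<^sub>z \<rightarrow> 0\<close>, and induction on \<open>n\<close> bounds the degree of
  \<open>\<Delta>\<^sub>y T\<close> with respect to \<open>x\<close> for \<open>y\<close> isomorphic to the \<open>n\<close>-th power of \<open>x\<close>.
\<close>

section \<open>Cokernels in abelian categories\<close>

lemma (in category) epicI:
  assumes "f \<in> homset C X Y"
    and "\<And>Z g h. g \<in> homset C Y Z \<Longrightarrow> h \<in> homset C Y Z \<Longrightarrow> g \<cdot>\<^bsub>C\<^esub> f = h \<cdot>\<^bsub>C\<^esub> f \<Longrightarrow> g = h"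
  shows "epic C f"
  using assms by (auto simp: epic_def homset_def)

lemma (in category) epicD:
  assumes "epic C f" "f \<in> homset C X Y" "g \<in> homset C Y Z" "h \<in> homset C Y Z"
    "g \<cdot>\<^bsub>C\<^esub> f = h \<cdot>\<^bsub>C\<^esub> f"
  shows "g = h"
  using assms by (auto simp: epic_def homset_def)

lemma (in category) epic_if_right_inverse:
  assumes f: "f \<in> homset C X Y" and g: "g \<in> homset C Y X" and fg: "f \<cdot>\<^bsub>C\<^esub> g = Ident C Y"
  shows "epic C f"
proof (rule epicI[OF f])
  fix Z h k assume h: "h \<in> homset C Y Z" and k: "k \<in> homset C Y Z"
    and eq: "h \<cdot>\<^bsub>C\<^esub> f = k \<cdot>\<^bsub>C\<^esub> f"
  have "h = (h \<cdot>\<^bsub>C\<^esub> f) \<cdot>\<^bsub>C\<^esub> g" using Comp_assoc[OF g f h] fg Ident_right[OF h] by simp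
  also have "\<dots> = k" using Comp_assoc[OF g f k] eq fg Ident_right[OF k] by simp
  finally show "h = k" .
qed

lemma (in category) isomorphism_right_inverse:
  assumes "isomorphism C f" "f \<in> homset C X Y"
  obtains g where "g \<in> homset C Y X" "f \<cdot>\<^bsub>C\<^esub> g = Ident C Y"
  using assms by (auto simp: isomorphism_def homset_def)

context abelian_category begin

text \<open>Turns nullness into an equation: every arrow into or out of \<open>X\<close> is its own
  composite with \<open>Ident A X\<close>, so it vanishes once that identity does. This form can be
  checked after composing with an epimorphism.\<close>

lemma null_object_iff:
  assumes X: "X \<in> Ob A"
  shows "null_object A X \<longleftrightarrow> Ident A X = Zero A X X"
proof
  assume "null_object A X"
  then show "Ident A X = Zero A X X"
    using X Ident_in_homset[OF X] Zero_in_homset[OF X X]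
    by (auto simp: null_object_def initial_object_def)
next
  assume eq: "Ident A X = Zero A X X"
  have "f = Zero A X Z" if "f \<in> homset A X Z" for f Z
    using Ident_right[OF that] Comp_Zero_right[OF X that] eq by simp
  then have "\<exists>!f. f \<in> homset A X Z" if "Z \<in> Ob A" for Z
    using Zero_in_homset[OF X that] by blast
  moreover have "f = Zero A Z X" if "f \<in> homset A Z X" for f Z
    using Ident_left[OF that] Comp_Zero_left[OF X that] eq by simp
  then have "\<exists>!f. f \<in> homset A Z X" if "Z \<in> Ob A" for Z
    using Zero_in_homset[OF that X] by blast
  ultimately show "null_object A X"
    using X by (simp add: null_object_def initial_object_def terminal_object_def)
qed

text \<open>An arrow out of a null object is zero, so \<open>Ident A Y\<close> and the zero
  endomorphism agree after composition with \<open>e\<close>, and \<open>e\<close> can be cancelled.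
  This is the case of degree at most -1 of closure under epimorphic images.\<close>

lemma null_object_epic:
  assumes e: "e \<in> homset A X Y" "epic A e" and X: "null_object A X"
  shows "null_object A Y"
proof -
  note XY = homset_Ob[OF e(1)]
  have "e = Zero A X Y"
    using Ident_right[OF e(1)] Comp_Zero_right[OF XY(1) e(1)] X null_object_iff[OF XY(1)] by simp
  then have "Ident A Y \<cdot>\<^bsub>A\<^esub> e = Zero A Y Y \<cdot>\<^bsub>A\<^esub> e"
    using Ident_left[OF e(1)] Comp_Zero_left[OF XY(2) e(1)] by simp
  then show ?thesis
    using epicD[OF e(2,1) Ident_in_homset[OF XY(2)] Zero_in_homset[OF XY(2) XY(2)]]
      null_object_iff[OF XY(2)] by simp
qed

section \<open>Recognising cokernels and null objects in right exact sequences\<close>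

lemma is_cokernel_iff:
  assumes "f \<in> homset A X Y" "p \<in> homset A Y Q"
  shows "is_cokernel A f p \<longleftrightarrow> p \<cdot>\<^bsub>A\<^esub> f = Zero A X Q \<and>
    (\<forall>Z. \<forall>g \<in> homset A Y Z. g \<cdot>\<^bsub>A\<^esub> f = Zero A X Z \<longrightarrow>
      (\<exists>!h. h \<in> homset A Q Z \<and> h \<cdot>\<^bsub>A\<^esub> p = g))"
proof -
  have "f \<in> Arr A" "Dom A f = X" "Cod A f = Y" "p \<in> Arr A" "Dom A p = Y" "Cod A p = Q"
    using assms by (simp_all add: homset_def)
  moreover have "Z \<in> Ob A" if "g \<in> homset A Y Z" for g Z by (rule homset_Ob(2)[OF that])
  ultimately show ?thesis unfolding is_cokernel_def by simp meson
qed

lemma epic_cokernel: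
  assumes f: "f \<in> homset A X Y" and p: "p \<in> homset A Y Q" and c: "is_cokernel A f p"
  shows "epic A p"
proof (rule epicI[OF p])
  fix Z g h assume g: "g \<in> homset A Q Z" and h: "h \<in> homset A Q Z"
    and eq: "g \<cdot>\<^bsub>A\<^esub> p = h \<cdot>\<^bsub>A\<^esub> p"
  have "(h \<cdot>\<^bsub>A\<^esub> p) \<cdot>\<^bsub>A\<^esub> f = Zero A X Z"
    using Comp_assoc[OF f p h] c Comp_Zero_right[OF _ h] homset_Ob[OF f]
    by (simp add: is_cokernel_iff[OF f p])
  then show "g = h"
    using c Comp_in_homset[OF p h] g h eq unfolding is_cokernel_iff[OF f p] by blast
qed

text \<open>Uniqueness of the factorisation follows from \<open>p\<close> being epic, so only
  existence is left to show.\<close>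

lemma is_cokernelI:
  assumes f: "f \<in> homset A X Y" and p: "p \<in> homset A Y Q" and e: "epic A p"
    and 0: "p \<cdot>\<^bsub>A\<^esub> f = Zero A X Q"
    and fac: "\<And>Z g. g \<in> homset A Y Z \<Longrightarrow> g \<cdot>\<^bsub>A\<^esub> f = Zero A X Z \<Longrightarrow>
      \<exists>h. h \<in> homset A Q Z \<and> h \<cdot>\<^bsub>A\<^esub> p = g"
  shows "is_cokernel A f p"
  unfolding is_cokernel_iff[OF f p]
proof (intro conjI allI ballI impI 0)
  fix Z g assume "g \<in> homset A Y Z" "g \<cdot>\<^bsub>A\<^esub> f = Zero A X Z"
  then show "\<exists>!h. h \<in> homset A Q Z \<and> h \<cdot>\<^bsub>A\<^esub> p = g"
    using fac epicD[OF e p] by metis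
qed

text \<open>Since \<open>X\<close> is null, \<open>f\<close> is zero and \<open>Ident A Y\<close>
  factors through \<open>p\<close>; since \<open>Q\<close> is null, \<open>p\<close> is zero, and so
  is the identity of \<open>Y\<close>. This is the case of degree at most -1 of closure under
  extensions.\<close>

lemma null_object_cokernel_middle:
  assumes f: "f \<in> homset A X Y" and p: "p \<in> homset A Y Q" and c: "is_cokernel A f p"
    and X: "null_object A X" and Q: "null_object A Q"
  shows "null_object A Y"
proof -
  note XY = homset_Ob[OF f] and QO = homset_Ob(2)[OF p]
  have "f = Zero A X Y"
    using Ident_right[OF f] Comp_Zero_right[OF XY(1) f] X null_object_iff[OF XY(1)] by simp
  then have "Ident A Y \<cdot>\<^bsub>A\<^esub> f = Zero A X Y" using Ident_left[OF f] by simp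
  then obtain h where h: "h \<in> homset A Q Y" "h \<cdot>\<^bsub>A\<^esub> p = Ident A Y"
    using c Ident_in_homset[OF XY(2)] unfolding is_cokernel_iff[OF f p] by blast
  have "p = Zero A Y Q"
    using Ident_left[OF p] Comp_Zero_left[OF QO p] Q null_object_iff[OF QO] by simp
  then show ?thesis
    using h Comp_Zero_right[OF XY(2) h(1)] null_object_iff[OF XY(2)] by simp
qed

text \<open>The right exact sequence coker \<open>f\<close> -> coker \<open>gf\<close> -> coker
  \<open>g\<close> -> 0 of a composite. If \<open>h\<close> kills \<open>a\<close>, then
  \<open>h q\<close> kills \<open>g\<close>, because this can be tested through \<open>p\<close>;
  hence \<open>h q\<close> factors through \<open>r\<close>, and cancelling \<open>q\<close> gives a
  factorisation of \<open>h\<close> through \<open>b\<close>.\<close>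

lemma is_cokernel_coker_comp:
  assumes f: "f \<in> homset A X Y" and g: "g \<in> homset A Y Z"
    and p: "p \<in> homset A Y P" "is_cokernel A f p"
    and q: "q \<in> homset A Z Q" "is_cokernel A (g \<cdot>\<^bsub>A\<^esub> f) q"
    and r: "r \<in> homset A Z R" "is_cokernel A g r"
    and a: "a \<in> homset A P Q" "a \<cdot>\<^bsub>A\<^esub> p = q \<cdot>\<^bsub>A\<^esub> g"
    and b: "b \<in> homset A Q R" "b \<cdot>\<^bsub>A\<^esub> q = r"
  shows "is_cokernel A a b"
proof (rule is_cokernelI[OF a(1) b(1)])
  note gf = Comp_in_homset[OF f g]
  note P = homset_Ob[OF a(1)] and R = homset_Ob(2)[OF r(1)]
  show "epic A b"
  proof (rule epicI[OF b(1)])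
    fix W h k assume h: "h \<in> homset A R W" and k: "k \<in> homset A R W"
      and eq: "h \<cdot>\<^bsub>A\<^esub> b = k \<cdot>\<^bsub>A\<^esub> b"
    have "h \<cdot>\<^bsub>A\<^esub> r = k \<cdot>\<^bsub>A\<^esub> r"
      using Comp_assoc[OF q(1) b(1) h] Comp_assoc[OF q(1) b(1) k] eq b(2) by simp
    then show "h = k" using epicD[OF epic_cokernel[OF g r] r(1) h k] by blast
  qed
  have "(b \<cdot>\<^bsub>A\<^esub> a) \<cdot>\<^bsub>A\<^esub> p = b \<cdot>\<^bsub>A\<^esub> (q \<cdot>\<^bsub>A\<^esub> g)" using Comp_assoc[OF p(1) a(1) b(1)] a(2) by simp
  also have "\<dots> = Zero A P R \<cdot>\<^bsub>A\<^esub> p"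
    using Comp_assoc[OF g q(1) b(1)] b(2) r(2) Comp_Zero_left[OF R p(1)]
    by (simp add: is_cokernel_iff[OF g r(1)])
  finally show "b \<cdot>\<^bsub>A\<^esub> a = Zero A P R"
    using epicD[OF epic_cokernel[OF f p] p(1) Comp_in_homset[OF a(1) b(1)]]
      Zero_in_homset[OF P(1) R] by blast
  fix W h assume h: "h \<in> homset A Q W" and 0: "h \<cdot>\<^bsub>A\<^esub> a = Zero A P W"
  have "(h \<cdot>\<^bsub>A\<^esub> q) \<cdot>\<^bsub>A\<^esub> g = (h \<cdot>\<^bsub>A\<^esub> a) \<cdot>\<^bsub>A\<^esub> p"
    using Comp_assoc[OF g q(1) h] Comp_assoc[OF p(1) a(1) h] a(2) by simp
  also have "\<dots> = Zero A Y W" using 0 Comp_Zero_left[OF homset_Ob(2)[OF h] p(1)] by simp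
  finally obtain k where k: "k \<in> homset A R W" "k \<cdot>\<^bsub>A\<^esub> r = h \<cdot>\<^bsub>A\<^esub> q"
    using r(2) Comp_in_homset[OF q(1) h] unfolding is_cokernel_iff[OF g r(1)] by blast
  have "(k \<cdot>\<^bsub>A\<^esub> b) \<cdot>\<^bsub>A\<^esub> q = h \<cdot>\<^bsub>A\<^esub> q" using Comp_assoc[OF q(1) b(1) k(1)] b(2) k(2) by simp
  then have "k \<cdot>\<^bsub>A\<^esub> b = h"
    using epicD[OF epic_cokernel[OF gf q] q(1) Comp_in_homset[OF b(1) k(1)] h] by blast
  then show "\<exists>k. k \<in> homset A R W \<and> k \<cdot>\<^bsub>A\<^esub> b = h" using k(1) by blast
qed

text \<open>The rows of the diagram are \<open>X\<^sub>i \<rightarrow> Y\<^sub>i \<rightarrow> Q\<^sub>i\<close>; its columns run from index 1 to 3.\<close>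

lemma is_cokernel_coker_right_exact:
  assumes f1: "f1 \<in> homset A X1 Y1" and f2: "f2 \<in> homset A X2 Y2" and f3: "f3 \<in> homset A X3 Y3"
    and p1: "p1 \<in> homset A Y1 Q1" "is_cokernel A f1 p1"
    and p2: "p2 \<in> homset A Y2 Q2" "is_cokernel A f2 p2"
    and p3: "p3 \<in> homset A Y3 Q3" "is_cokernel A f3 p3"
    and x: "xa \<in> homset A X1 X2" "xb \<in> homset A X2 X3" "is_cokernel A xa xb"
    and y: "ya \<in> homset A Y1 Y2" "yb \<in> homset A Y2 Y3" "is_cokernel A ya yb"
    and q: "qa \<in> homset A Q1 Q2" "qb \<in> homset A Q2 Q3"
    and sb: "yb \<cdot>\<^bsub>A\<^esub> f2 = f3 \<cdot>\<^bsub>A\<^esub> xb"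
    and ta: "qa \<cdot>\<^bsub>A\<^esub> p1 = p2 \<cdot>\<^bsub>A\<^esub> ya" and tb: "qb \<cdot>\<^bsub>A\<^esub> p2 = p3 \<cdot>\<^bsub>A\<^esub> yb"
  shows "is_cokernel A qa qb"
proof (rule is_cokernelI[OF q])
  note ep1 = epic_cokernel[OF f1 p1] and ep2 = epic_cokernel[OF f2 p2]
    and ep3 = epic_cokernel[OF f3 p3]
  note exb = epic_cokernel[OF x] and eyb = epic_cokernel[OF y]
  note Q1 = homset_Ob(2)[OF p1(1)] and Q3 = homset_Ob(2)[OF p3(1)]
  have X: "X1 \<in> Ob A" "X2 \<in> Ob A" "X3 \<in> Ob A" "Y1 \<in> Ob A"
    using homset_Ob f1 f2 f3 by blast+
  show "epic A qb"
  proof (rule epicI[OF q(2)])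
    fix W h k assume h: "h \<in> homset A Q3 W" and k: "k \<in> homset A Q3 W"
      and eq: "h \<cdot>\<^bsub>A\<^esub> qb = k \<cdot>\<^bsub>A\<^esub> qb"
    note hp = Comp_in_homset[OF p3(1) h] and kp = Comp_in_homset[OF p3(1) k]
    have "(h \<cdot>\<^bsub>A\<^esub> p3) \<cdot>\<^bsub>A\<^esub> yb = (h \<cdot>\<^bsub>A\<^esub> qb) \<cdot>\<^bsub>A\<^esub> p2"
      using Comp_assoc[OF y(2) p3(1) h] Comp_assoc[OF p2(1) q(2) h] tb by simp
    also have "\<dots> = (k \<cdot>\<^bsub>A\<^esub> p3) \<cdot>\<^bsub>A\<^esub> yb"
      using Comp_assoc[OF y(2) p3(1) k] Comp_assoc[OF p2(1) q(2) k] tb eq by simp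
    finally have "h \<cdot>\<^bsub>A\<^esub> p3 = k \<cdot>\<^bsub>A\<^esub> p3" by (rule epicD[OF eyb y(2) hp kp])
    then show "h = k" by (rule epicD[OF ep3 p3(1) h k])
  qed
  have "(qb \<cdot>\<^bsub>A\<^esub> qa) \<cdot>\<^bsub>A\<^esub> p1 = (p3 \<cdot>\<^bsub>A\<^esub> yb) \<cdot>\<^bsub>A\<^esub> ya"
    using Comp_assoc[OF p1(1) q] Comp_assoc[OF y(1) p2(1) q(2)] ta tb by simp
  also have "\<dots> = p3 \<cdot>\<^bsub>A\<^esub> Zero A Y1 Y3"
    using Comp_assoc[OF y(1,2) p3(1)] y(3) by (simp add: is_cokernel_iff[OF y(1,2)])
  also have "\<dots> = Zero A Q1 Q3 \<cdot>\<^bsub>A\<^esub> p1"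
    using Comp_Zero_right[OF X(4) p3(1)] Comp_Zero_left[OF Q3 p1(1)] by simp
  finally show "qb \<cdot>\<^bsub>A\<^esub> qa = Zero A Q1 Q3"
    by (rule epicD[OF ep1 p1(1) Comp_in_homset[OF q] Zero_in_homset[OF Q1 Q3]])
  \<comment> \<open>Diagram chase: \<open>g p2\<close> kills \<open>ya\<close>, so it factors
    through \<open>yb\<close> as some \<open>k\<close>; \<open>k f3\<close> vanishes because this
    can be tested after the epimorphism \<open>xb\<close>; hence \<open>k\<close> factors through
    \<open>p3\<close>, and the resulting arrow is the wanted one after cancelling
    \<open>p2\<close>.\<close>
  fix W g assume g: "g \<in> homset A Q2 W" and 0: "g \<cdot>\<^bsub>A\<^esub> qa = Zero A Q1 W"
  note W = homset_Ob(2)[OF g] and gp = Comp_in_homset[OF p2(1) g]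
  have "(g \<cdot>\<^bsub>A\<^esub> p2) \<cdot>\<^bsub>A\<^esub> ya = (g \<cdot>\<^bsub>A\<^esub> qa) \<cdot>\<^bsub>A\<^esub> p1"
    using Comp_assoc[OF y(1) p2(1) g] Comp_assoc[OF p1(1) q(1) g] ta by simp
  also have "\<dots> = Zero A Y1 W" using 0 Comp_Zero_left[OF W p1(1)] by simp
  finally obtain k where k: "k \<in> homset A Y3 W" "k \<cdot>\<^bsub>A\<^esub> yb = g \<cdot>\<^bsub>A\<^esub> p2"
    using y(3) gp unfolding is_cokernel_iff[OF y(1,2)] by blast
  have "(k \<cdot>\<^bsub>A\<^esub> f3) \<cdot>\<^bsub>A\<^esub> xb = (g \<cdot>\<^bsub>A\<^esub> p2) \<cdot>\<^bsub>A\<^esub> f2"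
    using Comp_assoc[OF x(2) f3 k(1)] Comp_assoc[OF f2 y(2) k(1)] sb k(2) by simp
  also have "\<dots> = g \<cdot>\<^bsub>A\<^esub> Zero A X2 Q2"
    using Comp_assoc[OF f2 p2(1) g] p2(2) by (simp add: is_cokernel_iff[OF f2 p2(1)])
  also have "\<dots> = Zero A X3 W \<cdot>\<^bsub>A\<^esub> xb"
    using Comp_Zero_right[OF X(2) g] Comp_Zero_left[OF W x(2)] by simp
  finally have "k \<cdot>\<^bsub>A\<^esub> f3 = Zero A X3 W"
    by (rule epicD[OF exb x(2) Comp_in_homset[OF f3 k(1)] Zero_in_homset[OF X(3) W]])
  then obtain h where h: "h \<in> homset A Q3 W" "h \<cdot>\<^bsub>A\<^esub> p3 = k"
    using p3(2) k(1) unfolding is_cokernel_iff[OF f3 p3(1)] by blast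
  have "(h \<cdot>\<^bsub>A\<^esub> qb) \<cdot>\<^bsub>A\<^esub> p2 = g \<cdot>\<^bsub>A\<^esub> p2"
    using Comp_assoc[OF p2(1) q(2) h(1)] Comp_assoc[OF y(2) p3(1) h(1)] tb h(2) k(2) by simp
  then have "h \<cdot>\<^bsub>A\<^esub> qb = g" by (rule epicD[OF ep2 p2(1) Comp_in_homset[OF q(2) h(1)] g])
  then show "\<exists>h. h \<in> homset A Q3 W \<and> h \<cdot>\<^bsub>A\<^esub> qb = g" using h(1) by blast
qed

end

section \<open>Natural transformations between cokernel functors\<close>

lemma natural_transformation_postcomp:
  assumes "natural_transformation C D F G \<tau>" "is_functor D E T"
  shows "natural_transformation C E (comp_fctr T F) (comp_fctr T G) (\<lambda>c. on_Arr T (\<tau> c))"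
proof -
  interpret n: natural_transformation C D F G \<tau> by fact
  interpret T: is_functor D E T by fact
  interpret TF: is_functor C E "comp_fctr T F"
    by (rule is_functor_comp_fctr[OF n.F.is_functor_axioms assms(2)])
  interpret TG: is_functor C E "comp_fctr T G"
    by (rule is_functor_comp_fctr[OF n.G.is_functor_axioms assms(2)])
  show ?thesis
  proof unfold_locales
    fix X assume "X \<in> Ob C"
    then show "on_Arr T (\<tau> X) \<in> homset E (on_Ob (comp_fctr T F) X) (on_Ob (comp_fctr T G) X)"
      using n.component_in_homset T.on_Arr_in_homset by (force simp: comp_fctr_def)
  next
    fix f X Y assume f: "f \<in> homset C X Y"
    note XY = n.F.src.homset_Ob[OF f]
    show "on_Arr T (\<tau> Y) \<cdot>\<^bsub>E\<^esub> on_Arr (comp_fctr T F) f = on_Arr (comp_fctr T G) f \<cdot>\<^bsub>E\<^esub> on_Arr T (\<tau> X)"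
      using n.naturality[OF f]
        T.on_Arr_Comp[OF n.F.on_Arr_in_homset[OF f] n.component_in_homset[OF XY(2)]]
        T.on_Arr_Comp[OF n.component_in_homset[OF XY(1)] n.G.on_Arr_in_homset[OF f]]
      by (simp add: comp_fctr_def)
  qed
qed

lemma natural_transformation_precomp:
  assumes "natural_transformation D E F G \<tau>" "is_functor C D S"
  shows "natural_transformation C E (comp_fctr F S) (comp_fctr G S) (\<lambda>c. \<tau> (on_Ob S c))"
proof -
  interpret n: natural_transformation D E F G \<tau> by fact
  interpret S: is_functor C D S by fact
  interpret FS: is_functor C E "comp_fctr F S"
    by (rule is_functor_comp_fctr[OF assms(2) n.F.is_functor_axioms])
  interpret GS: is_functor C E "comp_fctr G S"
    by (rule is_functor_comp_fctr[OF assms(2) n.G.is_functor_axioms])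
  show ?thesis
    using S.on_Ob_in_Ob S.on_Arr_in_homset n.component_in_homset n.naturality
    by unfold_locales (auto simp: comp_fctr_def)
qed

lemma natural_transformation_ident:
  assumes "is_functor C D F"
  shows "natural_transformation C D F F (\<lambda>c. Ident D (on_Ob F c))"
proof -
  interpret is_functor C D F by fact
  show ?thesis
    using on_Ob_in_Ob tgt.Ident_in_homset tgt.Ident_left tgt.Ident_right on_Arr_in_homset
    by unfold_locales (auto, metis)
qed

text \<open>Functors are records of total functions, so two of them may agree on \<open>Ob C\<close>
  and \<open>Arr C\<close> and still differ as terms. Strict associativity of the action identifies
  composites of stabilisers only in this weaker sense, and this lemma carries transformations across
  it.\<close>

lemma natural_transformation_cong:
  assumes "natural_transformation C D F G \<tau>" "is_functor C D F'" "is_functor C D G'"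
    and "\<And>c. c \<in> Ob C \<Longrightarrow> on_Ob F' c = on_Ob F c" "\<And>f. f \<in> Arr C \<Longrightarrow> on_Arr F' f = on_Arr F f"
    and "\<And>c. c \<in> Ob C \<Longrightarrow> on_Ob G' c = on_Ob G c" "\<And>f. f \<in> Arr C \<Longrightarrow> on_Arr G' f = on_Arr G f"
  shows "natural_transformation C D F' G' \<tau>"
proof -
  interpret n: natural_transformation C D F G \<tau> by fact
  interpret F': is_functor C D F' by fact
  interpret G': is_functor C D G' by fact
  show ?thesis
  proof unfold_locales
    fix X assume "X \<in> Ob C"
    then show "\<tau> X \<in> homset D (on_Ob F' X) (on_Ob G' X)"
      using n.component_in_homset assms by simp
  next
    fix f X Y assume f: "f \<in> homset C X Y"
    then have "f \<in> Arr C" by (simp add: homset_def)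
    then show "\<tau> Y \<cdot>\<^bsub>D\<^esub> on_Arr F' f = on_Arr G' f \<cdot>\<^bsub>D\<^esub> \<tau> X"
      using n.naturality[OF f] assms by simp
  qed
qed

lemma coker_proj_natural:
  assumes A: "abelian_category A" and \<tau>: "natural_transformation C A F G \<tau>"
  shows "natural_transformation C A G (coker_fctr C A G \<tau>) (\<lambda>c. coker_proj A (\<tau> c))"
proof -
  interpret A: abelian_category A by fact
  interpret n: natural_transformation C A F G \<tau> by fact
  interpret Q: is_functor C A "coker_fctr C A G \<tau>" by (rule is_functor_coker_fctr[OF A \<tau>])
  show ?thesis
  proof unfold_locales
    fix X assume "X \<in> Ob C"
    then show "coker_proj A (\<tau> X) \<in> homset A (on_Ob G X) (on_Ob (coker_fctr C A G \<tau>) X)"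
      using A.coker_proj_in_homset[OF n.component_in_homset] by (simp add: coker_fctr_def)
  next
    fix f X Y assume "f \<in> homset C X Y"
    then show "coker_proj A (\<tau> Y) \<cdot>\<^bsub>A\<^esub> on_Arr G f
        = on_Arr (coker_fctr C A G \<tau>) f \<cdot>\<^bsub>A\<^esub> coker_proj A (\<tau> X)"
      using coker_fctr_on_Arr(2)[OF A \<tau>] by simp
  qed
qed

lemma is_cokernel_coker_proj_component:
  assumes "abelian_category A" "natural_transformation C A F G \<tau>" "c \<in> Ob C"
  shows "is_cokernel A (\<tau> c) (coker_proj A (\<tau> c))"
  using abelian_category.is_cokernel_coker_proj[OF assms(1)]
    natural_transformation.component_in_homset[OF assms(2,3)] by (simp add: homset_def)

text \<open>Stated for an arbitrary objectwise cokernel \<pi> of \<tau> instead of the chosen one,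
  so that it also covers a cokernel functor precomposed with a stabiliser.\<close>

lemma cokernel_induced_natural:
  assumes A: "abelian_category A" and \<tau>: "natural_transformation C A F G \<tau>"
    and \<pi>: "natural_transformation C A G Q \<pi>" and \<pi>': "natural_transformation C A G' Q' \<pi>'"
    and \<psi>: "natural_transformation C A G G' \<psi>"
    and coker: "\<And>c. c \<in> Ob C \<Longrightarrow> is_cokernel A (\<tau> c) (\<pi> c)"
    and zero: "\<And>c. c \<in> Ob C \<Longrightarrow>
      \<pi>' c \<cdot>\<^bsub>A\<^esub> (\<psi> c \<cdot>\<^bsub>A\<^esub> \<tau> c) = Zero A (on_Ob F c) (on_Ob Q' c)"
  obtains \<theta> where "natural_transformation C A Q Q' \<theta>"
    "\<And>c. c \<in> Ob C \<Longrightarrow> \<theta> c \<cdot>\<^bsub>A\<^esub> \<pi> c = \<pi>' c \<cdot>\<^bsub>A\<^esub> \<psi> c"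
proof -
  interpret A: abelian_category A by fact
  interpret t: natural_transformation C A F G \<tau> by fact
  interpret p: natural_transformation C A G Q \<pi> by fact
  interpret p': natural_transformation C A G' Q' \<pi>' by fact
  interpret s: natural_transformation C A G G' \<psi> by fact
  have "\<exists>h. h \<in> homset A (on_Ob Q c) (on_Ob Q' c) \<and> h \<cdot>\<^bsub>A\<^esub> \<pi> c = \<pi>' c \<cdot>\<^bsub>A\<^esub> \<psi> c"
    if c: "c \<in> Ob C" for c
  proof -
    note tc = t.component_in_homset[OF c] and pc = p.component_in_homset[OF c]
      and pc' = p'.component_in_homset[OF c] and sc = s.component_in_homset[OF c]
    show ?thesis
      using coker[OF c] zero[OF c] A.Comp_assoc[OF tc sc pc'] A.Comp_in_homset[OF sc pc']
      unfolding A.is_cokernel_iff[OF tc pc] by metis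
  qed
  then obtain \<theta> where \<theta>: "\<And>c. c \<in> Ob C \<Longrightarrow> \<theta> c \<in> homset A (on_Ob Q c) (on_Ob Q' c)"
    "\<And>c. c \<in> Ob C \<Longrightarrow> \<theta> c \<cdot>\<^bsub>A\<^esub> \<pi> c = \<pi>' c \<cdot>\<^bsub>A\<^esub> \<psi> c" by metis
  have "natural_transformation C A Q Q' \<theta>"
  proof unfold_locales
    fix f X Y assume f: "f \<in> homset C X Y"
    note X = t.F.src.homset_Ob(1)[OF f] and Y = t.F.src.homset_Ob(2)[OF f]
    note tX = t.component_in_homset[OF X] and pX = p.component_in_homset[OF X]
      and pY = p.component_in_homset[OF Y] and sX = s.component_in_homset[OF X]
      and sY = s.component_in_homset[OF Y] and pX' = p'.component_in_homset[OF X]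
      and pY' = p'.component_in_homset[OF Y]
    note Gf = t.G.on_Arr_in_homset[OF f] and Qf = p.G.on_Arr_in_homset[OF f]
      and Gf' = p'.F.on_Arr_in_homset[OF f] and Qf' = p'.G.on_Arr_in_homset[OF f]
    \<comment> \<open>Naturality of \<theta> is checked after composing with the epimorphism
      \<open>\<pi> X\<close>, where it reduces to naturality of \<pi>, \<psi> and \<pi>'.\<close>
    have "(\<theta> Y \<cdot>\<^bsub>A\<^esub> on_Arr Q f) \<cdot>\<^bsub>A\<^esub> \<pi> X = (\<pi>' Y \<cdot>\<^bsub>A\<^esub> \<psi> Y) \<cdot>\<^bsub>A\<^esub> on_Arr G f"
      using A.Comp_assoc[OF pX Qf \<theta>(1)[OF Y]] A.Comp_assoc[OF Gf pY \<theta>(1)[OF Y]]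
        p.naturality[OF f] \<theta>(2)[OF Y] by simp
    also have "\<dots> = (on_Arr Q' f \<cdot>\<^bsub>A\<^esub> \<pi>' X) \<cdot>\<^bsub>A\<^esub> \<psi> X"
      using A.Comp_assoc[OF Gf sY pY'] A.Comp_assoc[OF sX Gf' pY']
        s.naturality[OF f] p'.naturality[OF f] by simp
    also have "\<dots> = (on_Arr Q' f \<cdot>\<^bsub>A\<^esub> \<theta> X) \<cdot>\<^bsub>A\<^esub> \<pi> X"
      using A.Comp_assoc[OF sX pX' Qf'] A.Comp_assoc[OF pX \<theta>(1)[OF X] Qf'] \<theta>(2)[OF X] by simp
    finally show "\<theta> Y \<cdot>\<^bsub>A\<^esub> on_Arr Q f = on_Arr Q' f \<cdot>\<^bsub>A\<^esub> \<theta> X"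
      by (rule A.epicD[OF A.epic_cokernel[OF tX pX coker[OF X]] pX
          A.Comp_in_homset[OF Qf \<theta>(1)[OF Y]] A.Comp_in_homset[OF \<theta>(1)[OF X] Qf']])
  qed (fact \<theta>(1))
  then show ?thesis using that \<theta>(2) by blast
qed

text \<open>The arrows \<phi> serve only to show that \<open>coker_proj A (\<tau>' c)\<close> kills
  \<open>\<psi> c\<close> after \<open>\<tau> c\<close>, so they form a mere family. In the
  applications they can be any arrows that make the squares commute.\<close>

lemma coker_fctr_induced_natural:
  assumes A: "abelian_category A" and \<tau>: "natural_transformation C A F G \<tau>"
    and \<pi>: "natural_transformation C A G Q \<pi>"
    and coker: "\<And>c. c \<in> Ob C \<Longrightarrow> is_cokernel A (\<tau> c) (\<pi> c)"
    and \<tau>': "natural_transformation C A F' G' \<tau>'"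
    and \<psi>: "natural_transformation C A G G' \<psi>"
    and \<phi>: "\<And>c. c \<in> Ob C \<Longrightarrow> \<phi> c \<in> homset A (on_Ob F c) (on_Ob F' c)"
    and square: "\<And>c. c \<in> Ob C \<Longrightarrow> \<psi> c \<cdot>\<^bsub>A\<^esub> \<tau> c = \<tau>' c \<cdot>\<^bsub>A\<^esub> \<phi> c"
  obtains \<theta> where "natural_transformation C A Q (coker_fctr C A G' \<tau>') \<theta>"
    "\<And>c. c \<in> Ob C \<Longrightarrow> \<theta> c \<cdot>\<^bsub>A\<^esub> \<pi> c = coker_proj A (\<tau>' c) \<cdot>\<^bsub>A\<^esub> \<psi> c"
proof -
  interpret A: abelian_category A by fact
  interpret t': natural_transformation C A F' G' \<tau>' by fact
  have zero: "coker_proj A (\<tau>' c) \<cdot>\<^bsub>A\<^esub> (\<psi> c \<cdot>\<^bsub>A\<^esub> \<tau> c)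
      = Zero A (on_Ob F c) (on_Ob (coker_fctr C A G' \<tau>') c)" if c: "c \<in> Ob C" for c
  proof -
    note tc = t'.component_in_homset[OF c]
    note pc = A.coker_proj_in_homset[OF tc]
    show ?thesis
      using A.Comp_assoc[OF \<phi>[OF c] tc pc] A.coker_proj_Comp[OF tc] square[OF c]
        A.Comp_Zero_left[OF A.homset_Ob(2)[OF pc] \<phi>[OF c]] by (simp add: coker_fctr_def)
  qed
  show ?thesis
    using cokernel_induced_natural[OF A \<tau> \<pi> coker_proj_natural[OF A \<tau>'] \<psi> coker zero] that
    by blast
qed

section \<open>Closure properties of the degree\<close>

text \<open>The functor \<Delta> of the overview. It is literally the term in the recursion of
  \<open>degree_lt\<close>, so unfolding one step of the recursion produces it directly.\<close>

abbreviation diff_fctr ::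
  "('o1, 'a1, 'z1) cat_scheme \<Rightarrow> ('o2, 'a2, 'z2) ab_cat_scheme \<Rightarrow>
    ('o1, 'a1, 'o1, 'a1) fctr \<Rightarrow> ('o1 \<Rightarrow> 'a1) \<Rightarrow>
    ('o1, 'a1, 'o2, 'a2) fctr \<Rightarrow> ('o1, 'a1, 'o2, 'a2) fctr" where
  "diff_fctr C A s \<iota> T \<equiv> coker_fctr C A (comp_fctr T s) (\<lambda>c. on_Arr T (\<iota> c))"

text \<open>Functoriality of \<Delta> in the functor it is applied to. The square that induces
  \<theta> is naturality of \<alpha> at the arrow \<open>\<iota> c\<close> from \<open>c\<close> to
  \<open>on_Ob s c\<close>.\<close>

lemma diff_fctr_natural:
  assumes A: "abelian_category A" and s: "natural_transformation C C id_fctr s \<iota>"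
    and \<alpha>: "natural_transformation C A F G \<alpha>"
  obtains \<theta> where "natural_transformation C A (diff_fctr C A s \<iota> F) (diff_fctr C A s \<iota> G) \<theta>"
    "\<And>c. c \<in> Ob C \<Longrightarrow> \<theta> c \<cdot>\<^bsub>A\<^esub> coker_proj A (on_Arr F (\<iota> c))
      = coker_proj A (on_Arr G (\<iota> c)) \<cdot>\<^bsub>A\<^esub> \<alpha> (on_Ob s c)"
proof -
  interpret a: natural_transformation C A F G \<alpha> by fact
  interpret s: natural_transformation C C id_fctr s \<iota> by fact
  note wF = natural_transformation_whisker[OF s a.F.is_functor_axioms]
    and wG = natural_transformation_whisker[OF s a.G.is_functor_axioms]
  have square: "\<alpha> (on_Ob s c) \<cdot>\<^bsub>A\<^esub> on_Arr F (\<iota> c) = on_Arr G (\<iota> c) \<cdot>\<^bsub>A\<^esub> \<alpha> c" if "c \<in> Ob C" for c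
    using a.naturality s.component_in_homset[OF that] by (simp add: id_fctr_def)
  show ?thesis
    using coker_fctr_induced_natural[OF A wF coker_proj_natural[OF A wF]
        is_cokernel_coker_proj_component[OF A wF] wG
        natural_transformation_precomp[OF \<alpha> s.G.is_functor_axioms] a.component_in_homset square]
      that by blast
qed

lemma degree_lt_zero_fctr:
  assumes "abelian_category A"
    and "\<And>i. i \<in> I \<Longrightarrow> natural_transformation C C id_fctr (s i) (\<iota> i)"
    and "is_functor C A T" "zero_fctr C A T"
  shows "degree_lt C A I s \<iota> n T"
proof (induction n)
  case 0
  then show ?case using assms(4) by simp
next
  case (Suc n)
  show ?case by (rule degree_lt_Suc[OF assms(1-3) Suc])
qed

text \<open>If \<open>k h = l h\<close>, composing with \<open>p\<close> gives
  \<open>k q g = l q g\<close>; cancelling first \<open>g\<close> and then \<open>q\<close> gives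
  \<open>k = l\<close>.\<close>

lemma epic_cokernel_induced:
  assumes "abelian_category A"
    and f: "f \<in> homset A X' X" and p: "p \<in> homset A X P" "is_cokernel A f p"
    and f': "f' \<in> homset A Y' Y" and q: "q \<in> homset A Y Q" "is_cokernel A f' q"
    and g: "g \<in> homset A X Y" "epic A g" and h: "h \<in> homset A P Q"
    and eq: "h \<cdot>\<^bsub>A\<^esub> p = q \<cdot>\<^bsub>A\<^esub> g"
  shows "epic A h"
proof -
  interpret A: abelian_category A by fact
  show ?thesis
  proof (rule A.epicI[OF h])
    fix W k l assume k: "k \<in> homset A Q W" and l: "l \<in> homset A Q W"
      and e: "k \<cdot>\<^bsub>A\<^esub> h = l \<cdot>\<^bsub>A\<^esub> h"
    have "(k \<cdot>\<^bsub>A\<^esub> q) \<cdot>\<^bsub>A\<^esub> g = (l \<cdot>\<^bsub>A\<^esub> q) \<cdot>\<^bsub>A\<^esub> g"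
      using A.Comp_assoc[OF g(1) q(1) k] A.Comp_assoc[OF g(1) q(1) l]
        A.Comp_assoc[OF p(1) h k] A.Comp_assoc[OF p(1) h l] eq e by simp
    then have "k \<cdot>\<^bsub>A\<^esub> q = l \<cdot>\<^bsub>A\<^esub> q"
      using A.epicD[OF g(2,1)] A.Comp_in_homset[OF q(1)] k l by blast
    then show "k = l" by (rule A.epicD[OF A.epic_cokernel[OF f' q] q(1) k l])
  qed
qed

text \<open>Induction on \<open>n\<close>: \<Delta> turns an objectwise epimorphism into an
  objectwise epimorphism, which lowers the claim by one degree. The bottom case is that quotients of
  null objects are null.\<close>

lemma degree_lt_epic:
  assumes A: "abelian_category A"
    and s: "\<And>i. i \<in> I \<Longrightarrow> natural_transformation C C id_fctr (s i) (\<iota> i)"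
    and "natural_transformation C A F G \<alpha>" "\<And>c. c \<in> Ob C \<Longrightarrow> epic A (\<alpha> c)"
    and "degree_lt C A I s \<iota> n F"
  shows "degree_lt C A I s \<iota> n G"
  using assms(3-)
proof (induction n arbitrary: F G \<alpha>)
  case 0
  interpret a: natural_transformation C A F G \<alpha> by (rule 0)
  show ?case
    using 0 abelian_category.null_object_epic[OF A] a.component_in_homset
    by (fastforce simp: zero_fctr_def)
next
  case (Suc n)
  interpret A: abelian_category A by fact
  interpret a: natural_transformation C A F G \<alpha> by (rule Suc)
  have "degree_lt C A I s \<iota> n (diff_fctr C A (s i) (\<iota> i) G)" if i: "i \<in> I" for i
  proof -
    interpret s: natural_transformation C C id_fctr "s i" "\<iota> i" by (rule s[OF i])
    note wF = natural_transformation_whisker[OF s[OF i] a.F.is_functor_axioms]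
      and wG = natural_transformation_whisker[OF s[OF i] a.G.is_functor_axioms]
    obtain \<theta> where \<theta>: "natural_transformation C A
        (diff_fctr C A (s i) (\<iota> i) F) (diff_fctr C A (s i) (\<iota> i) G) \<theta>"
      "\<And>c. c \<in> Ob C \<Longrightarrow> \<theta> c \<cdot>\<^bsub>A\<^esub> coker_proj A (on_Arr F (\<iota> i c))
        = coker_proj A (on_Arr G (\<iota> i c)) \<cdot>\<^bsub>A\<^esub> \<alpha> (on_Ob (s i) c)"
      using diff_fctr_natural[OF A s[OF i] Suc.prems(1)] by blast
    have "epic A (\<theta> c)" if c: "c \<in> Ob C" for c
    proof -
      note sc = s.G.on_Ob_in_Ob[OF c]
      note F = natural_transformation.component_in_homset[OF wF c]
        natural_transformation.component_in_homset[OF coker_proj_natural[OF A wF] c]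
        is_cokernel_coker_proj_component[OF A wF c]
      note G = natural_transformation.component_in_homset[OF wG c]
        natural_transformation.component_in_homset[OF coker_proj_natural[OF A wG] c]
        is_cokernel_coker_proj_component[OF A wG c]
      have "\<alpha> (on_Ob (s i) c) \<in> homset A (on_Ob (comp_fctr F (s i)) c) (on_Ob (comp_fctr G (s i)) c)"
        using a.component_in_homset[OF sc] by (simp add: comp_fctr_def)
      then show ?thesis
        using epic_cokernel_induced[OF A F G _ Suc.prems(2)[OF sc]
          natural_transformation.component_in_homset[OF \<theta>(1) c] \<theta>(2)[OF c]] by blast
    qed
    then show ?thesis using Suc.IH[OF \<theta>(1)] Suc.prems(3) i by simp
  qed
  then show ?case by simp
qed

text \<open>Right exactness is what \<Delta> hands on from one degree to the next, so the induction
  runs over sequences in which \<alpha> may fail to be monic.\<close>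

lemma degree_lt_right_exact:
  assumes A: "abelian_category A"
    and s: "\<And>i. i \<in> I \<Longrightarrow> natural_transformation C C id_fctr (s i) (\<iota> i)"
    and "natural_transformation C A F G \<alpha>" "natural_transformation C A G H \<beta>"
    and "\<And>c. c \<in> Ob C \<Longrightarrow> is_cokernel A (\<alpha> c) (\<beta> c)"
    and "degree_lt C A I s \<iota> n F" "degree_lt C A I s \<iota> n H"
  shows "degree_lt C A I s \<iota> n G"
  using assms(3-)
proof (induction n arbitrary: F G H \<alpha> \<beta>)
  case 0
  interpret a: natural_transformation C A F G \<alpha> by (rule 0)
  interpret b: natural_transformation C A G H \<beta> by (rule 0)
  show ?case
    using 0 abelian_category.null_object_cokernel_middle[OF A a.component_in_homset
        b.component_in_homset]
    by (simp add: zero_fctr_def)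
next
  case (Suc n)
  interpret A: abelian_category A by fact
  interpret a: natural_transformation C A F G \<alpha> by (rule Suc)
  interpret b: natural_transformation C A G H \<beta> by (rule Suc)
  have "degree_lt C A I s \<iota> n (diff_fctr C A (s i) (\<iota> i) G)" if i: "i \<in> I" for i
  proof -
    interpret s: natural_transformation C C id_fctr "s i" "\<iota> i" by (rule s[OF i])
    note wF = natural_transformation_whisker[OF s[OF i] a.F.is_functor_axioms]
      and wG = natural_transformation_whisker[OF s[OF i] a.G.is_functor_axioms]
      and wH = natural_transformation_whisker[OF s[OF i] b.G.is_functor_axioms]
    obtain \<theta> where \<theta>: "natural_transformation C A
        (diff_fctr C A (s i) (\<iota> i) F) (diff_fctr C A (s i) (\<iota> i) G) \<theta>"
      "\<And>c. c \<in> Ob C \<Longrightarrow> \<theta> c \<cdot>\<^bsub>A\<^esub> coker_proj A (on_Arr F (\<iota> i c))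
        = coker_proj A (on_Arr G (\<iota> i c)) \<cdot>\<^bsub>A\<^esub> \<alpha> (on_Ob (s i) c)"
      using diff_fctr_natural[OF A s[OF i] Suc.prems(1)] by blast
    obtain \<eta> where \<eta>: "natural_transformation C A
        (diff_fctr C A (s i) (\<iota> i) G) (diff_fctr C A (s i) (\<iota> i) H) \<eta>"
      "\<And>c. c \<in> Ob C \<Longrightarrow> \<eta> c \<cdot>\<^bsub>A\<^esub> coker_proj A (on_Arr G (\<iota> i c))
        = coker_proj A (on_Arr H (\<iota> i c)) \<cdot>\<^bsub>A\<^esub> \<beta> (on_Ob (s i) c)"
      using diff_fctr_natural[OF A s[OF i] Suc.prems(2)] by blast
    have "is_cokernel A (\<theta> c) (\<eta> c)" if c: "c \<in> Ob C" for c
    proof -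
      note sc = s.G.on_Ob_in_Ob[OF c]
      note F = natural_transformation.component_in_homset[OF wF c]
        natural_transformation.component_in_homset[OF coker_proj_natural[OF A wF] c]
        is_cokernel_coker_proj_component[OF A wF c]
      note G = natural_transformation.component_in_homset[OF wG c]
        natural_transformation.component_in_homset[OF coker_proj_natural[OF A wG] c]
        is_cokernel_coker_proj_component[OF A wG c]
      note H = natural_transformation.component_in_homset[OF wH c]
        natural_transformation.component_in_homset[OF coker_proj_natural[OF A wH] c]
        is_cokernel_coker_proj_component[OF A wH c]
      have y: "\<alpha> (on_Ob (s i) c) \<in> homset A (on_Ob (comp_fctr F (s i)) c) (on_Ob (comp_fctr G (s i)) c)"
        "\<beta> (on_Ob (s i) c) \<in> homset A (on_Ob (comp_fctr G (s i)) c) (on_Ob (comp_fctr H (s i)) c)"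
        using a.component_in_homset[OF sc] b.component_in_homset[OF sc]
        by (simp_all add: comp_fctr_def)
      have "\<beta> (on_Ob (s i) c) \<cdot>\<^bsub>A\<^esub> on_Arr G (\<iota> i c) = on_Arr H (\<iota> i c) \<cdot>\<^bsub>A\<^esub> \<beta> c"
        using b.naturality s.component_in_homset[OF c] by (simp add: id_fctr_def)
      \<comment> \<open>The given sequence enters twice: at \<open>c\<close> it is the column of the
        sources of the stabilising arrows, at \<open>on_Ob (s i) c\<close> the column of their
        targets. Passing to cokernels gives the new sequence.\<close>
      then show ?thesis
        using A.is_cokernel_coker_right_exact[OF F(1) G(1) H(1) F(2,3) G(2,3) H(2,3)
          a.component_in_homset[OF c] b.component_in_homset[OF c] Suc.prems(3)[OF c]
          y Suc.prems(3)[OF sc] natural_transformation.component_in_homset[OF \<theta>(1) c]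
          natural_transformation.component_in_homset[OF \<eta>(1) c] _ \<theta>(2)[OF c] \<eta>(2)[OF c]] by blast
    qed
    then show ?thesis using Suc.IH[OF \<theta>(1) \<eta>(1)] Suc.prems(4,5) i by simp
  qed
  then show ?case by simp
qed

text \<open>The common tool for comparing difference functors: an epimorphism \<psi> of targets,
  compatible with the sources, induces an epimorphism from \<open>Q\<close> onto the cokernel of
  \<tau>'. Below, \<psi> comes from the braiding, from an identity and from an isomorphism in
  \<open>M\<close>.\<close>

lemma degree_lt_coker_fctr_epic:
  assumes A: "abelian_category A"
    and s: "\<And>i. i \<in> I \<Longrightarrow> natural_transformation C C id_fctr (s i) (\<iota> i)"
    and \<tau>: "natural_transformation C A F G \<tau>" and \<pi>: "natural_transformation C A G Q \<pi>"
    and coker: "\<And>c. c \<in> Ob C \<Longrightarrow> is_cokernel A (\<tau> c) (\<pi> c)"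
    and \<tau>': "natural_transformation C A F' G' \<tau>'"
    and \<psi>: "natural_transformation C A G G' \<psi>" and epic: "\<And>c. c \<in> Ob C \<Longrightarrow> epic A (\<psi> c)"
    and \<phi>: "\<And>c. c \<in> Ob C \<Longrightarrow> \<phi> c \<in> homset A (on_Ob F c) (on_Ob F' c)"
    and square: "\<And>c. c \<in> Ob C \<Longrightarrow> \<psi> c \<cdot>\<^bsub>A\<^esub> \<tau> c = \<tau>' c \<cdot>\<^bsub>A\<^esub> \<phi> c"
    and deg: "degree_lt C A I s \<iota> n Q"
  shows "degree_lt C A I s \<iota> n (coker_fctr C A G' \<tau>')"
proof -
  obtain \<theta> where \<theta>: "natural_transformation C A Q (coker_fctr C A G' \<tau>') \<theta>"
    "\<And>c. c \<in> Ob C \<Longrightarrow> \<theta> c \<cdot>\<^bsub>A\<^esub> \<pi> c = coker_proj A (\<tau>' c) \<cdot>\<^bsub>A\<^esub> \<psi> c"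
    using coker_fctr_induced_natural[OF A \<tau> \<pi> coker \<tau>' \<psi> \<phi> square] by blast
  have "epic A (\<theta> c)" if c: "c \<in> Ob C" for c
    by (rule epic_cokernel_induced[OF A
        natural_transformation.component_in_homset[OF \<tau> c]
        natural_transformation.component_in_homset[OF \<pi> c] coker[OF c]
        natural_transformation.component_in_homset[OF \<tau>' c]
        natural_transformation.component_in_homset[OF coker_proj_natural[OF A \<tau>'] c]
        is_cokernel_coker_proj_component[OF A \<tau>' c]
        natural_transformation.component_in_homset[OF \<psi> c] epic[OF c]
        natural_transformation.component_in_homset[OF \<theta>(1) c] \<theta>(2)[OF c]])
  then show ?thesis using degree_lt_epic[OF A s \<theta>(1) _ deg] by blast
qed

lemma degree_lt_coker_fctr_comp:
  assumes A: "abelian_category A"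
    and s: "\<And>i. i \<in> I \<Longrightarrow> natural_transformation C C id_fctr (s i) (\<iota> i)"
    and \<sigma>: "natural_transformation C A F G \<sigma>" and \<tau>: "natural_transformation C A G H \<tau>"
    and \<rho>: "natural_transformation C A F H \<rho>"
    and comp: "\<And>c. c \<in> Ob C \<Longrightarrow> \<rho> c = \<tau> c \<cdot>\<^bsub>A\<^esub> \<sigma> c"
    and deg: "degree_lt C A I s \<iota> n (coker_fctr C A G \<sigma>)"
      "degree_lt C A I s \<iota> n (coker_fctr C A H \<tau>)"
  shows "degree_lt C A I s \<iota> n (coker_fctr C A H \<rho>)"
proof -
  interpret A: abelian_category A by fact
  interpret s: natural_transformation C A F G \<sigma> by fact
  interpret t: natural_transformation C A G H \<tau> by fact
  note p\<sigma> = coker_proj_natural[OF A \<sigma>]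
    and p\<tau> = coker_proj_natural[OF A \<tau>] and p\<rho> = coker_proj_natural[OF A \<rho>]
  note H = natural_transformation_ident[OF t.G.is_functor_axioms]
  have sq1: "\<tau> c \<cdot>\<^bsub>A\<^esub> \<sigma> c = \<rho> c \<cdot>\<^bsub>A\<^esub> Ident A (on_Ob F c)" if c: "c \<in> Ob C" for c
    using A.Ident_right[OF natural_transformation.component_in_homset[OF \<rho> c]] comp[OF c] by simp
  have idF: "Ident A (on_Ob F c) \<in> homset A (on_Ob F c) (on_Ob F c)" if "c \<in> Ob C" for c
    using A.Ident_in_homset s.F.on_Ob_in_Ob that by blast
  \<comment> \<open>\<alpha> is induced by the identity on the source \<open>F\<close> and \<tau> on
    targets; below, \<beta> is induced by \<sigma> on sources and the identity on the target
    \<open>H\<close>.\<close>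
  obtain \<alpha> where \<alpha>: "natural_transformation C A (coker_fctr C A G \<sigma>) (coker_fctr C A H \<rho>) \<alpha>"
    "\<And>c. c \<in> Ob C \<Longrightarrow> \<alpha> c \<cdot>\<^bsub>A\<^esub> coker_proj A (\<sigma> c) = coker_proj A (\<rho> c) \<cdot>\<^bsub>A\<^esub> \<tau> c"
    using coker_fctr_induced_natural[OF A \<sigma> p\<sigma> is_cokernel_coker_proj_component[OF A \<sigma>] \<rho> \<tau>
        idF sq1] by blast
  have sq2: "Ident A (on_Ob H c) \<cdot>\<^bsub>A\<^esub> \<rho> c = \<tau> c \<cdot>\<^bsub>A\<^esub> \<sigma> c" if c: "c \<in> Ob C" for c
    using A.Ident_left[OF natural_transformation.component_in_homset[OF \<rho> c]] comp[OF c] by simp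
  obtain \<beta> where \<beta>: "natural_transformation C A (coker_fctr C A H \<rho>) (coker_fctr C A H \<tau>) \<beta>"
    "\<And>c. c \<in> Ob C \<Longrightarrow> \<beta> c \<cdot>\<^bsub>A\<^esub> coker_proj A (\<rho> c) = coker_proj A (\<tau> c) \<cdot>\<^bsub>A\<^esub> Ident A (on_Ob H c)"
    using coker_fctr_induced_natural[OF A \<rho> p\<rho> is_cokernel_coker_proj_component[OF A \<rho>] \<tau> H
        s.component_in_homset sq2] by blast
  have "is_cokernel A (\<alpha> c) (\<beta> c)" if c: "c \<in> Ob C" for c
  proof (rule A.is_cokernel_coker_comp[OF s.component_in_homset[OF c] t.component_in_homset[OF c]
        natural_transformation.component_in_homset[OF p\<sigma> c]
        is_cokernel_coker_proj_component[OF A \<sigma> c]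
        natural_transformation.component_in_homset[OF p\<rho> c] _
        natural_transformation.component_in_homset[OF p\<tau> c]
        is_cokernel_coker_proj_component[OF A \<tau> c]
        natural_transformation.component_in_homset[OF \<alpha>(1) c] \<alpha>(2)[OF c]
        natural_transformation.component_in_homset[OF \<beta>(1) c]])
    show "is_cokernel A (\<tau> c \<cdot>\<^bsub>A\<^esub> \<sigma> c) (coker_proj A (\<rho> c))"
      using is_cokernel_coker_proj_component[OF A \<rho> c] comp[OF c] by simp
    show "\<beta> c \<cdot>\<^bsub>A\<^esub> coker_proj A (\<rho> c) = coker_proj A (\<tau> c)"
      using \<beta>(2)[OF c] A.Ident_right[OF natural_transformation.component_in_homset[OF p\<tau> c]] by simp
  qed
  then show ?thesis using degree_lt_right_exact[OF A s \<alpha>(1) \<beta>(1) _ deg] by blast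
qed

lemma degree_lt_index_mono:
  assumes "J \<subseteq> I" "degree_lt C A I s \<iota> n T"
  shows "degree_lt C A J s \<iota> n T"
  using assms(2) by (induction n arbitrary: T) (use assms(1) in auto)

section \<open>Stabilisers of modules over braided categories\<close>

lemma homset_prod_cat_iff:
  "(u, f) \<in> homset (prod_cat C D) (a, c) (b, d) \<longleftrightarrow> u \<in> homset C a b \<and> f \<in> homset D c d"
  by (auto simp: homset_def prod_cat_def)

lemma prod_fctr_on_Arr_Comp:
  assumes "is_functor (prod_cat C1 C2) D F" "u \<in> homset C1 a b" "v \<in> homset C1 b c"
    "f \<in> homset C2 a' b'" "g \<in> homset C2 b' c'"
  shows "on_Arr F (v, g) \<cdot>\<^bsub>D\<^esub> on_Arr F (u, f) = on_Arr F (v \<cdot>\<^bsub>C1\<^esub> u, g \<cdot>\<^bsub>C2\<^esub> f)"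
  using is_functor.on_Arr_Comp[OF assms(1), of "(u, f)" "(a, a')" "(b, b')" "(v, g)" "(c, c')"] assms(2-)
  by (simp add: homset_prod_cat_iff) (simp add: prod_cat_def)

text \<open>Initiality of the unit is the condition under which \<open>from_Unit\<close>, and with
  it \<open>stab_trans\<close>, is determined.\<close>

locale braided_left_module =
  strict_braided_monoidal_category M + strict_left_module M C act
  for M :: "('mo, 'ma, 'z) braided_cat_scheme"
    and C :: "('co, 'ca, 'y) cat_scheme"
    and act :: "('mo \<times> 'co, 'ma \<times> 'ca, 'co, 'ca) fctr" +
  assumes initial_Unit: "initial_object M (Unit M)"
begin

section \<open>Arrows of \<open>M\<close> acting as transformations between stabilisers\<close>

abbreviation s where "s \<equiv> stab M act"
abbreviation \<iota> where "\<iota> \<equiv> stab_trans M C act"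

lemma from_Unit_in_homset: "y \<in> Ob M \<Longrightarrow> from_Unit M y \<in> homset M (Unit M) y"
  using theI'[of "\<lambda>f. f \<in> homset M (Unit M) y"] initial_Unit
  unfolding from_Unit_def initial_object_def by blast

lemma from_Unit_unique: "f \<in> homset M (Unit M) y \<Longrightarrow> f = from_Unit M y"
  using from_Unit_in_homset[of y] initial_Unit homset_Ob[of f "Unit M" y]
  unfolding initial_object_def by blast

lemma stabiliser: "y \<in> Ob M \<Longrightarrow> natural_transformation C C id_fctr (s y) (\<iota> y)"
  using stab_natural[OF strict_left_module_axioms initial_Unit] .

lemma is_functor_stab: "y \<in> Ob M \<Longrightarrow> is_functor C C (s y)"
  using natural_transformation.axioms(2)[OF stabiliser] .

lemma tensor_in_Ob: "y \<in> Ob M \<Longrightarrow> z \<in> Ob M \<Longrightarrow> tensor_Ob M y z \<in> Ob M"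
  using tensor.on_Ob_in_Ob[of "(y, z)"] by (simp add: prod_cat_def)

lemma tensor_Arr_in_homset:
  "u \<in> homset M a b \<Longrightarrow> v \<in> homset M c d \<Longrightarrow>
    tensor_Arr M u v \<in> homset M (tensor_Ob M a c) (tensor_Ob M b d)"
  using tensor.on_Arr_in_homset[OF iffD2[OF homset_prod_cat_iff, OF conjI]] .

lemma tensor_Ident:
  "y \<in> Ob M \<Longrightarrow> z \<in> Ob M \<Longrightarrow>
    tensor_Arr M (Ident M y) (Ident M z) = Ident M (tensor_Ob M y z)"
  using tensor.on_Arr_Ident[of "(y, z)"] by (simp add: prod_cat_def)

lemma act_in_Ob: "y \<in> Ob M \<Longrightarrow> c \<in> Ob C \<Longrightarrow> on_Ob act (y, c) \<in> Ob C"
  using action.on_Ob_in_Ob[of "(y, c)"] by (simp add: prod_cat_def)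

lemma act_in_homset:
  "u \<in> homset M a b \<Longrightarrow> f \<in> homset C c d \<Longrightarrow>
    on_Arr act (u, f) \<in> homset C (on_Ob act (a, c)) (on_Ob act (b, d))"
  using action.on_Arr_in_homset[OF iffD2[OF homset_prod_cat_iff, OF conjI]] .

lemma act_Ident: "y \<in> Ob M \<Longrightarrow> c \<in> Ob C \<Longrightarrow> on_Arr act (Ident M y, Ident C c) = Ident C (on_Ob act (y, c))"
  using action.on_Arr_Ident[of "(y, c)"] by (simp add: prod_cat_def)

lemmas act_Comp = prod_fctr_on_Arr_Comp[OF action.is_functor_axioms]

lemma act_Comp_Ident:
  assumes "u \<in> homset M a b" "v \<in> homset M b d" "c \<in> Ob C"
  shows "on_Arr act (v, Ident C c) \<cdot>\<^bsub>C\<^esub> on_Arr act (u, Ident C c) = on_Arr act (v \<cdot>\<^bsub>M\<^esub> u, Ident C c)"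
  using act_Comp[OF assms(1,2) module.Ident_in_homset[OF assms(3)] module.Ident_in_homset[OF assms(3)]]
    module.Ident_left[OF module.Ident_in_homset[OF assms(3)]] by simp

text \<open>By bifunctoriality of the action, both sides of the naturality square at
  \<open>f\<close> equal \<open>on_Arr act (u, f)\<close>.\<close>

lemma stab_map_natural:
  assumes u: "u \<in> homset M a b"
  shows "natural_transformation C C (s a) (s b) (\<lambda>c. on_Arr act (u, Ident C c))"
proof -
  note ab = homset_Ob[OF u]
  interpret a: is_functor C C "s a" by (rule is_functor_stab[OF ab(1)])
  interpret b: is_functor C C "s b" by (rule is_functor_stab[OF ab(2)])
  show ?thesis
  proof unfold_locales
    fix X assume "X \<in> Ob C"
    then show "on_Arr act (u, Ident C X) \<in> homset C (on_Ob (s a) X) (on_Ob (s b) X)"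
      using act_in_homset[OF u module.Ident_in_homset] by (simp add: stab_def)
  next
    fix f X Y assume f: "f \<in> homset C X Y"
    note XY = module.homset_Ob[OF f]
    show "on_Arr act (u, Ident C Y) \<cdot>\<^bsub>C\<^esub> on_Arr (s a) f = on_Arr (s b) f \<cdot>\<^bsub>C\<^esub> on_Arr act (u, Ident C X)"
      using act_Comp[OF Ident_in_homset[OF ab(1)] u f module.Ident_in_homset[OF XY(2)]]
        act_Comp[OF u Ident_in_homset[OF ab(2)] module.Ident_in_homset[OF XY(1)] f]
        Ident_left[OF u] Ident_right[OF u] module.Ident_left[OF f] module.Ident_right[OF f]
      by (simp add: stab_def)
  qed
qed

lemma stab_map_right_inverse:
  assumes "u \<in> homset M a b" "v \<in> homset M b a" "u \<cdot>\<^bsub>M\<^esub> v = Ident M b" "c \<in> Ob C"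
  shows "on_Arr act (u, Ident C c) \<cdot>\<^bsub>C\<^esub> on_Arr act (v, Ident C c) = Ident C (on_Ob act (b, c))"
  using act_Comp_Ident[OF assms(2,1,4)] assms(3) act_Ident[OF homset_Ob(2)[OF assms(1)] assms(4)]
  by simp

text \<open>The inverse of \<open>u\<close> acts as a right inverse, and \<open>T\<close> preserves
  it. Being epic is the form in which this enters the comparison of cokernels.\<close>

lemma epic_stab_map:
  assumes T: "is_functor C A T" and u: "u \<in> homset M a b" "isomorphism M u" and c: "c \<in> Ob C"
  shows "epic A (on_Arr T (on_Arr act (u, Ident C c)))"
proof -
  interpret T: is_functor C A T by fact
  obtain v where v: "v \<in> homset M b a" "u \<cdot>\<^bsub>M\<^esub> v = Ident M b"
    using isomorphism_right_inverse[OF u(2,1)] by blast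
  note idc = module.Ident_in_homset[OF c]
  note U = act_in_homset[OF u(1) idc] and V = act_in_homset[OF v(1) idc]
  show ?thesis
    using T.tgt.epic_if_right_inverse[OF T.on_Arr_in_homset[OF U] T.on_Arr_in_homset[OF V]]
      T.on_Arr_Comp[OF V U] stab_map_right_inverse[OF u(1) v c]
      T.on_Arr_Ident[OF act_in_Ob[OF homset_Ob(2)[OF u(1)] c]] by simp
qed

lemma stab_stab_on_Ob:
  "y \<in> Ob M \<Longrightarrow> z \<in> Ob M \<Longrightarrow> c \<in> Ob C \<Longrightarrow>
    on_Ob (comp_fctr (s y) (s z)) c = on_Ob (s (tensor_Ob M y z)) c"
  by (simp add: comp_fctr_def stab_def act_assoc_Ob)

lemma stab_stab_on_Arr:
  assumes "y \<in> Ob M" "z \<in> Ob M" "f \<in> Arr C"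
  shows "on_Arr (comp_fctr (s y) (s z)) f = on_Arr (s (tensor_Ob M y z)) f"
  using act_assoc_Arr[of "Ident M y" "Ident M z" f] Ident_in_homset assms tensor_Ident
  by (simp add: comp_fctr_def stab_def homset_def)

text \<open>Stabilising by \<open>y\<close> after \<open>z\<close> inserts the new factor on the
  left of \<open>z\<close>, while applying \<open>s z\<close> to the stabilising arrow, as in the
  next lemma, inserts it on the right. The braiding will mediate between the two.\<close>

lemma stab_trans_stab:
  assumes y: "y \<in> Ob M" and z: "z \<in> Ob M" and c: "c \<in> Ob C"
  shows "\<iota> y (on_Ob (s z) c) = on_Arr act (tensor_Arr M (from_Unit M y) (Ident M z), Ident C c)"
proof -
  have "from_Unit M y \<in> Arr M" "Ident M z \<in> Arr M" "Ident C c \<in> Arr C"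
    using from_Unit_in_homset[OF y] Ident_in_homset[OF z] module.Ident_in_homset[OF c]
    by (simp_all add: homset_def)
  from act_assoc_Arr[OF this] show ?thesis
    using act_Ident[OF z c] by (simp add: stab_trans_def stab_def)
qed

lemma stab_stab_trans:
  assumes y: "y \<in> Ob M" and z: "z \<in> Ob M" and c: "c \<in> Ob C"
  shows "on_Arr (s z) (\<iota> y c) = on_Arr act (tensor_Arr M (Ident M z) (from_Unit M y), Ident C c)"
proof -
  have "Ident M z \<in> Arr M" "from_Unit M y \<in> Arr M" "Ident C c \<in> Arr C"
    using from_Unit_in_homset[OF y] Ident_in_homset[OF z] module.Ident_in_homset[OF c]
    by (simp_all add: homset_def)
  from act_assoc_Arr[OF this] show ?thesis by (simp add: stab_trans_def stab_def)
qed

section \<open>The braiding and bounds on the degree with respect to \<open>x\<close>\<close>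

lemma Braiding_in_homset:
  "y \<in> Ob M \<Longrightarrow> z \<in> Ob M \<Longrightarrow> Braiding M (y, z) \<in> homset M (tensor_Ob M y z) (tensor_Ob M z y)"
  using braiding.component_in_homset[of "(y, z)"]
  by (simp add: comp_fctr_def swap_fctr_def prod_cat_def)

text \<open>Naturality of the braiding at the pair of \<open>from_Unit M y\<close> and the identity
  of \<open>z\<close>. By strict unitality, \<open>Braiding M (Unit M, z)\<close> is an endomorphism
  of \<open>z\<close>; it stays unevaluated and later plays the part of \<phi>.\<close>

lemma Braiding_from_Unit:
  assumes y: "y \<in> Ob M" and z: "z \<in> Ob M"
  shows "Braiding M (y, z) \<cdot>\<^bsub>M\<^esub> tensor_Arr M (from_Unit M y) (Ident M z)
    = tensor_Arr M (Ident M z) (from_Unit M y) \<cdot>\<^bsub>M\<^esub> Braiding M (Unit M, z)"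
  using braiding.naturality[of "(from_Unit M y, Ident M z)" "(Unit M, z)" "(y, z)"]
    from_Unit_in_homset[OF y] Ident_in_homset[OF z]
  by (simp add: homset_prod_cat_iff comp_fctr_def swap_fctr_def)

text \<open>The braiding induces an objectwise epimorphism from
  \<open>(\<Delta>\<^sub>x T) s\<^sub>z\<close> onto \<open>\<Delta>\<^sub>x (T s\<^sub>z)\<close>,
  which suffices to transfer the bound. The induction hypothesis is applied to
  \<open>\<Delta>\<^sub>x T\<close>, hence the induction over all \<open>T\<close>.\<close>

lemma degree_lt_comp_stab:
  assumes A: "abelian_category A" and x: "x \<in> Ob M" and z: "z \<in> Ob M"
    and "is_functor C A T" "degree_lt C A {x} s \<iota> n T"
  shows "degree_lt C A {x} s \<iota> n (comp_fctr T (s z))"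
  using assms(4-)
proof (induction n arbitrary: T)
  case 0
  then show ?case
    using act_in_Ob[OF z] by (simp add: zero_fctr_def comp_fctr_def stab_def)
next
  case (Suc n)
  interpret A: abelian_category A by fact
  interpret T: is_functor C A T by (rule Suc)
  note sx = is_functor_stab[OF x] and sz = is_functor_stab[OF z]
  note Tsz = is_functor_comp_fctr[OF sz T.is_functor_axioms]
  note \<tau> = natural_transformation_whisker[OF stabiliser[OF x] T.is_functor_axioms]
  note \<pi> = coker_proj_natural[OF A \<tau>]
  note \<tau>' = natural_transformation_whisker[OF stabiliser[OF x] Tsz]
  let ?b = "\<lambda>c. on_Arr act (Braiding M (x, z), Ident C c)"
  \<comment> \<open>\<open>?b\<close> is natural between the stabilisers of the two tensor products;
    it is transferred to the composites of stabilisers, which agree with these on objects and arrows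
    of \<open>C\<close>.\<close>
  have "natural_transformation C C (comp_fctr (s x) (s z)) (comp_fctr (s z) (s x)) ?b"
    by (rule natural_transformation_cong[OF stab_map_natural[OF Braiding_in_homset[OF x z]]
        is_functor_comp_fctr[OF sz sx] is_functor_comp_fctr[OF sx sz]])
      (simp_all add: stab_stab_on_Ob stab_stab_on_Arr x z)
  from natural_transformation_postcomp[OF this T.is_functor_axioms]
  have \<psi>: "natural_transformation C A (comp_fctr (comp_fctr T (s x)) (s z))
      (comp_fctr (comp_fctr T (s z)) (s x)) (\<lambda>c. on_Arr T (?b c))"
    by (simp add: comp_fctr_def comp_assoc)
  let ?\<phi> = "\<lambda>c. on_Arr act (Braiding M (Unit M, z), Ident C c)"
  have \<phi>: "?\<phi> c \<in> homset C (on_Ob act (z, c)) (on_Ob act (z, c))" if "c \<in> Ob C" for c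
    using act_in_homset[OF Braiding_in_homset[OF Unit_in_Ob z] module.Ident_in_homset[OF that]]
      Unit_left_Ob[OF z] Unit_right_Ob[OF z] by simp
  have "degree_lt C A {x} s \<iota> n (diff_fctr C A (s x) (\<iota> x) (comp_fctr T (s z)))"
  proof (rule degree_lt_coker_fctr_epic[OF A _ natural_transformation_precomp[OF \<tau> sz]
        natural_transformation_precomp[OF \<pi> sz] _ \<tau>' \<psi>])
    show "natural_transformation C C id_fctr (s i) (\<iota> i)" if "i \<in> {x}" for i
      using that stabiliser x by simp
    show "degree_lt C A {x} s \<iota> n (comp_fctr (diff_fctr C A (s x) (\<iota> x) T) (s z))"
      using Suc.IH[OF is_functor_coker_fctr[OF A \<tau>]] Suc.prems(2) by simp
  next
    fix c assume c: "c \<in> Ob C"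
    have zc: "on_Ob (s z) c \<in> Ob C" using act_in_Ob[OF z c] by (simp add: stab_def)
    show "is_cokernel A (on_Arr T (\<iota> x (on_Ob (s z) c)))
        (coker_proj A (on_Arr T (\<iota> x (on_Ob (s z) c))))"
      by (rule is_cokernel_coker_proj_component[OF A \<tau> zc])
    show "epic A (on_Arr T (?b c))"
      by (rule epic_stab_map[OF T.is_functor_axioms Braiding_in_homset[OF x z] Braiding_iso[OF x z] c])
    show "on_Arr T (?\<phi> c) \<in> homset A (on_Ob (comp_fctr T (s z)) c) (on_Ob (comp_fctr T (s z)) c)"
      using T.on_Arr_in_homset[OF \<phi>[OF c]] by (simp add: comp_fctr_def stab_def)
    let ?i = "tensor_Arr M (from_Unit M x) (Ident M z)"
      and ?j = "tensor_Arr M (Ident M z) (from_Unit M x)"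
    note ii = tensor_Arr_in_homset[OF from_Unit_in_homset[OF x] Ident_in_homset[OF z]]
      and jj = tensor_Arr_in_homset[OF Ident_in_homset[OF z] from_Unit_in_homset[OF x]]
      and b = Braiding_in_homset[OF x z] and b' = Braiding_in_homset[OF Unit_in_Ob z]
      and idc = module.Ident_in_homset[OF c]
    \<comment> \<open>The image under the action and \<open>T\<close> of the naturality square of
      the braiding at \<open>from_Unit M x\<close>.\<close>
    have "on_Arr T (?b c) \<cdot>\<^bsub>A\<^esub> on_Arr T (on_Arr act (?i, Ident C c))
        = on_Arr T (on_Arr act (?j, Ident C c)) \<cdot>\<^bsub>A\<^esub> on_Arr T (?\<phi> c)"
      using T.on_Arr_Comp[OF act_in_homset[OF ii idc] act_in_homset[OF b idc]]
        T.on_Arr_Comp[OF act_in_homset[OF b' idc] act_in_homset[OF jj idc]]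
        act_Comp_Ident[OF ii b c] act_Comp_Ident[OF b' jj c] Braiding_from_Unit[OF x z] by simp
    then show "on_Arr T (?b c) \<cdot>\<^bsub>A\<^esub> on_Arr T (\<iota> x (on_Ob (s z) c))
        = on_Arr (comp_fctr T (s z)) (\<iota> x c) \<cdot>\<^bsub>A\<^esub> on_Arr T (?\<phi> c)"
      using stab_trans_stab[OF x z c] stab_stab_trans[OF x z c] by (simp add: comp_fctr_def)
  qed
  then show ?case by simp
qed

text \<open>Stabilising by the unit is the identity transformation, whose cokernel is zero, so the
  bound holds for every \<open>n\<close>. This starts the induction over the powers of
  \<open>x\<close>.\<close>

lemma degree_lt_diff_Unit:
  assumes A: "abelian_category A" and x: "x \<in> Ob M" and T: "is_functor C A T"
  shows "degree_lt C A {x} s \<iota> n (diff_fctr C A (s (Unit M)) (\<iota> (Unit M)) T)"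
proof (rule degree_lt_zero_fctr[OF A])
  interpret A: abelian_category A by fact
  interpret T: is_functor C A T by fact
  note \<tau> = natural_transformation_whisker[OF stabiliser[OF Unit_in_Ob] T]
  show "natural_transformation C C id_fctr (s i) (\<iota> i)" if "i \<in> {x}" for i
    using that stabiliser x by simp
  show "is_functor C A (diff_fctr C A (s (Unit M)) (\<iota> (Unit M)) T)"
    by (rule is_functor_coker_fctr[OF A \<tau>])
  have "null_object A (Cod A (coker_proj A (on_Arr T (\<iota> (Unit M) c))))" if c: "c \<in> Ob C" for c
  proof -
    note idc = module.Ident_in_homset[OF c]
    have "\<iota> (Unit M) c = Ident C c"
      using from_Unit_unique[OF Ident_in_homset[OF Unit_in_Ob], symmetric] act_Unit_Arr idc
      by (simp add: stab_trans_def homset_def)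
    then have eq: "on_Arr T (\<iota> (Unit M) c) = Ident A (on_Ob T c)" using T.on_Arr_Ident[OF c] by simp
    note Tc = T.on_Ob_in_Ob[OF c]
    note i = A.Ident_in_homset[OF Tc]
    let ?p = "coker_proj A (Ident A (on_Ob T c))"
    note p = A.coker_proj_in_homset[OF i]
    note Q = A.homset_Ob(2)[OF p]
    \<comment> \<open>The projection from an identity vanishes because its composite with that
      identity does; cancelling it shows that the identity of the cokernel is zero.\<close>
    have "Ident A (Cod A ?p) \<cdot>\<^bsub>A\<^esub> ?p = Zero A (Cod A ?p) (Cod A ?p) \<cdot>\<^bsub>A\<^esub> ?p"
      using A.coker_proj_Comp[OF i] A.Ident_right[OF p] A.Ident_left[OF p]
        A.Comp_Zero_left[OF Q p] by simp
    then have "Ident A (Cod A ?p) = Zero A (Cod A ?p) (Cod A ?p)"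
      by (rule A.coker_proj_cancel[OF i A.Ident_in_homset[OF Q] A.Zero_in_homset[OF Q Q]])
    then show ?thesis using A.null_object_iff[OF Q] eq by simp
  qed
  then show "zero_fctr C A (diff_fctr C A (s (Unit M)) (\<iota> (Unit M)) T)"
    by (simp add: zero_fctr_def coker_fctr_def)
qed

text \<open>\<open>T -> T s\<^sub>y\<close> with \<open>y = x \<otimes> z\<close> factors as
  \<open>T -> T s\<^sub>z\<close> followed by \<open>?g\<close>. The cokernel of \<open>?g\<close>
  is controlled by \<open>(\<Delta>\<^sub>x T) s\<^sub>z\<close>, so the sequence of a composite
  bounds \<open>\<Delta>\<^sub>y T\<close>.\<close>

lemma degree_lt_diff_tensor:
  assumes A: "abelian_category A" and x: "x \<in> Ob M" and z: "z \<in> Ob M" and T: "is_functor C A T"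
    and deg: "degree_lt C A {x} s \<iota> n (diff_fctr C A (s x) (\<iota> x) T)"
      "degree_lt C A {x} s \<iota> n (diff_fctr C A (s z) (\<iota> z) T)"
  shows "degree_lt C A {x} s \<iota> n
    (diff_fctr C A (s (tensor_Ob M x z)) (\<iota> (tensor_Ob M x z)) T)"
proof -
  interpret A: abelian_category A by fact
  interpret T: is_functor C A T by fact
  let ?y = "tensor_Ob M x z" and ?i = "tensor_Arr M (from_Unit M x) (Ident M z)"
  let ?g = "\<lambda>c. on_Arr T (on_Arr act (?i, Ident C c))"
  note y = tensor_in_Ob[OF x z]
  note sx = is_functor_stab[OF x] and sz = is_functor_stab[OF z] and sy = is_functor_stab[OF y]
  have st: "natural_transformation C C id_fctr (s i) (\<iota> i)" if "i \<in> {x}" for i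
    using that stabiliser x by simp
  have i: "?i \<in> homset M z ?y"
    using tensor_Arr_in_homset[OF from_Unit_in_homset[OF x] Ident_in_homset[OF z]]
      Unit_left_Ob[OF z] by simp
  note g = natural_transformation_postcomp[OF stab_map_natural[OF i] T]
  note wx = natural_transformation_whisker[OF stabiliser[OF x] T]
    and wy = natural_transformation_whisker[OF stabiliser[OF y] T]
    and wz = natural_transformation_whisker[OF stabiliser[OF z] T]
  note \<pi> = coker_proj_natural[OF A wx]
  have Tsy: "on_Ob (comp_fctr T (s ?y)) c \<in> Ob A" if "c \<in> Ob C" for c
    using T.on_Ob_in_Ob[OF act_in_Ob[OF y that]] by (simp add: comp_fctr_def stab_def)
  \<comment> \<open>\<open>T s\<^sub>x s\<^sub>z\<close> and \<open>T s\<^sub>y\<close> agree on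
    objects and arrows of \<open>C\<close> but need not be equal records; the transformation with
    identity components passes from one to the other.\<close>
  have \<psi>: "natural_transformation C A (comp_fctr (comp_fctr T (s x)) (s z)) (comp_fctr T (s ?y))
      (\<lambda>c. Ident A (on_Ob (comp_fctr T (s ?y)) c))"
    by (rule natural_transformation_cong[OF natural_transformation_ident[OF is_functor_comp_fctr[OF sy T]]
        is_functor_comp_fctr[OF sz is_functor_comp_fctr[OF sx T]] is_functor_comp_fctr[OF sy T]])
      (use stab_stab_on_Ob[OF x z] stab_stab_on_Arr[OF x z] in \<open>simp_all add: comp_fctr_def\<close>)
  have "degree_lt C A {x} s \<iota> n (coker_fctr C A (comp_fctr T (s ?y)) ?g)"
  proof (rule degree_lt_coker_fctr_epic[OF A st natural_transformation_precomp[OF wx sz]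
        natural_transformation_precomp[OF \<pi> sz] _ g \<psi>])
    show "degree_lt C A {x} s \<iota> n (comp_fctr (diff_fctr C A (s x) (\<iota> x) T) (s z))"
      by (rule degree_lt_comp_stab[OF A x z is_functor_coker_fctr[OF A wx] deg(1)])
  next
    fix c assume c: "c \<in> Ob C"
    have zc: "on_Ob (s z) c \<in> Ob C" using act_in_Ob[OF z c] by (simp add: stab_def)
    show "is_cokernel A (on_Arr T (\<iota> x (on_Ob (s z) c)))
        (coker_proj A (on_Arr T (\<iota> x (on_Ob (s z) c))))"
      by (rule is_cokernel_coker_proj_component[OF A wx zc])
    note I = A.Ident_in_homset[OF Tsy[OF c]]
    show "epic A (Ident A (on_Ob (comp_fctr T (s ?y)) c))"
      by (rule A.epic_if_right_inverse[OF I I A.Ident_left[OF I]])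
    have Tz: "on_Ob (comp_fctr T (s z)) c \<in> Ob A"
      using T.on_Ob_in_Ob[OF zc] by (simp add: comp_fctr_def)
    show "Ident A (on_Ob (comp_fctr T (s z)) c)
        \<in> homset A (on_Ob (comp_fctr T (s z)) c) (on_Ob (comp_fctr T (s z)) c)"
      by (rule A.Ident_in_homset[OF Tz])
    note gc = natural_transformation.component_in_homset[OF g c]
    show "Ident A (on_Ob (comp_fctr T (s ?y)) c) \<cdot>\<^bsub>A\<^esub> on_Arr T (\<iota> x (on_Ob (s z) c))
        = ?g c \<cdot>\<^bsub>A\<^esub> Ident A (on_Ob (comp_fctr T (s z)) c)"
      unfolding stab_trans_stab[OF x z c] A.Ident_left[OF gc] A.Ident_right[OF gc] ..
  qed
  moreover have "on_Arr T (\<iota> ?y c) = ?g c \<cdot>\<^bsub>A\<^esub> on_Arr T (\<iota> z c)" if c: "c \<in> Ob C" for c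
  proof -
    note iz = from_Unit_in_homset[OF z] and idc = module.Ident_in_homset[OF c]
    \<comment> \<open>Two arrows out of the initial unit into the same object coincide, and this
      gives the factorisation of the stabilising arrow.\<close>
    have "?i \<cdot>\<^bsub>M\<^esub> from_Unit M z = from_Unit M ?y"
      by (rule from_Unit_unique[OF Comp_in_homset[OF iz i]])
    then show ?thesis
      using T.on_Arr_Comp[OF act_in_homset[OF iz idc] act_in_homset[OF i idc]]
        act_Comp_Ident[OF iz i c] by (simp add: stab_trans_def)
  qed
  ultimately show ?thesis
    using degree_lt_coker_fctr_comp[OF A st wz g wy _ deg(2)] by blast
qed

text \<open>The action of \<open>u\<close> commutes with the stabilising arrows, again by uniqueness
  of arrows out of the unit, and so induces an epimorphism from \<open>\<Delta>\<^sub>z T\<close>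
  onto \<open>\<Delta>\<^sub>y T\<close>.\<close>

lemma degree_lt_diff_iso:
  assumes A: "abelian_category A" and x: "x \<in> Ob M" and T: "is_functor C A T"
    and u: "u \<in> homset M z y" "isomorphism M u"
    and deg: "degree_lt C A {x} s \<iota> n (diff_fctr C A (s z) (\<iota> z) T)"
  shows "degree_lt C A {x} s \<iota> n (diff_fctr C A (s y) (\<iota> y) T)"
proof -
  interpret A: abelian_category A by fact
  interpret T: is_functor C A T by fact
  note z = homset_Ob(1)[OF u(1)] and y = homset_Ob(2)[OF u(1)]
  note wy = natural_transformation_whisker[OF stabiliser[OF y] T]
    and wz = natural_transformation_whisker[OF stabiliser[OF z] T]
  show ?thesis
  proof (rule degree_lt_coker_fctr_epic[OF A _ wz coker_proj_natural[OF A wz]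
        is_cokernel_coker_proj_component[OF A wz] wy
        natural_transformation_postcomp[OF stab_map_natural[OF u(1)] T]
        epic_stab_map[OF T u] _ _ deg])
    show "natural_transformation C C id_fctr (s i) (\<iota> i)" if "i \<in> {x}" for i
      using that stabiliser x by simp
    fix c assume c: "c \<in> Ob C"
    show "Ident A (on_Ob T c) \<in> homset A (on_Ob T c) (on_Ob T c)"
      by (rule A.Ident_in_homset[OF T.on_Ob_in_Ob[OF c]])
    note iz = from_Unit_in_homset[OF z] and idc = module.Ident_in_homset[OF c]
    have "u \<cdot>\<^bsub>M\<^esub> from_Unit M z = from_Unit M y"
      by (rule from_Unit_unique[OF Comp_in_homset[OF iz u(1)]])
    then have "on_Arr T (on_Arr act (u, Ident C c)) \<cdot>\<^bsub>A\<^esub> on_Arr T (\<iota> z c) = on_Arr T (\<iota> y c)"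
      using T.on_Arr_Comp[OF act_in_homset[OF iz idc] act_in_homset[OF u(1) idc]]
        act_Comp_Ident[OF iz u(1) c] by (simp add: stab_trans_def)
    then show "on_Arr T (on_Arr act (u, Ident C c)) \<cdot>\<^bsub>A\<^esub> on_Arr T (\<iota> z c)
        = on_Arr T (\<iota> y c) \<cdot>\<^bsub>A\<^esub> Ident A (on_Ob T c)"
      using A.Ident_right[OF natural_transformation.component_in_homset[OF wy c]] by simp
  qed
qed

text \<open>Membership in \<open>Ob M\<close> is carried along because the tensor step requires it
  of the smaller power.\<close>

lemma degree_lt_diff_tensor_power:
  assumes "abelian_category A" "x \<in> Ob M" "is_functor C A T"
    and "degree_lt C A {x} s \<iota> n (diff_fctr C A (s x) (\<iota> x) T)"
  shows "tensor_power M x k \<in> Ob M \<and>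
    degree_lt C A {x} s \<iota> n (diff_fctr C A (s (tensor_power M x k)) (\<iota> (tensor_power M x k)) T)"
proof (induction k)
  case 0
  then show ?case using Unit_in_Ob degree_lt_diff_Unit assms by simp
next
  case (Suc k)
  then show ?case using tensor_in_Ob[OF assms(2)] degree_lt_diff_tensor[OF assms(1,2) _ assms(3,4)] by simp
qed

section \<open>From powers of the generator to all objects\<close>

lemma degree_lt_diff_generated:
  assumes A: "abelian_category A" and gen: "generated_by M x" and T: "is_functor C A T"
    and deg: "degree_lt C A {x} s \<iota> (Suc n) T" and y: "y \<in> Ob M"
  shows "degree_lt C A {x} s \<iota> n (diff_fctr C A (s y) (\<iota> y) T)"
proof -
  have x: "x \<in> Ob M" using gen by (simp add: generated_by_def)
  obtain k where k: "isomorphic M y (tensor_power M x k)" using gen y unfolding generated_by_def by blast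
  \<comment> \<open>Generation provides an isomorphism from \<open>y\<close> to the power; its
    inverse is taken, since the bound passes from the source to the target.\<close>
  then obtain u where u: "u \<in> homset M (tensor_power M x k) y" "isomorphism M u"
    unfolding isomorphic_def isomorphism_def homset_def by fastforce
  show ?thesis
    using degree_lt_diff_iso[OF A x T u] degree_lt_diff_tensor_power[OF A x T] deg by simp
qed

text \<open>Each \<open>\<Delta>\<^sub>y T\<close> has degree with respect to \<open>x\<close> one
  lower than the bound on \<open>T\<close>, so the induction hypothesis applies to it and makes the
  remaining differences range over all of \<open>Ob M\<close>.\<close>

lemma degree_lt_generator:
  assumes A: "abelian_category A" and gen: "generated_by M x"
    and "is_functor C A T" "degree_lt C A {x} s \<iota> n T"
  shows "degree_lt C A (Ob M) s \<iota> n T"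
  using assms(3-)
proof (induction n arbitrary: T)
  case 0
  then show ?case by simp
next
  case (Suc n)
  have "degree_lt C A (Ob M) s \<iota> n (diff_fctr C A (s y) (\<iota> y) T)" if y: "y \<in> Ob M" for y
    by (rule Suc.IH[OF is_functor_coker_fctr[OF A natural_transformation_whisker[OF stabiliser[OF y]
        Suc.prems(1)]] degree_lt_diff_generated[OF A gen Suc.prems y]])
  then show ?case by simp
qed

end

theorem proposition2p8:
  fixes M :: "('mo, 'ma) braided_cat"
    and x :: 'mo
    and C :: "('co, 'ca) cat"
    and act :: "('mo \<times> 'co, 'ma \<times> 'ca, 'co, 'ca) fctr"
    and A :: "('ao, 'aa) ab_cat"
    and T :: "('co, 'ca, 'ao, 'aa) fctr"
  assumes "strict_braided_monoidal_category M"
    and "null_object M (Unit M)"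
    and "generated_by M x"
    and "strict_left_module M C act"
    and "abelian_category A"
    and "is_functor C A T"
  shows "degree C A {x} (stab M act) (stab_trans M C act) T =
    degree C A (Ob M) (stab M act) (stab_trans M C act) T"
proof -
  interpret braided_left_module M C act
    using assms(1,2,4) by (simp add: braided_left_module_def braided_left_module_axioms_def null_object_def)
  have "{x} \<subseteq> Ob M" using assms(3) by (simp add: generated_by_def)
  \<comment> \<open>The bounds agree for every \<open>n\<close>: forwards by the generator argument,
    backwards by restricting the index set. Hence both degrees are the infimum of the same
    set.\<close>
  then have "degree_lt C A {x} (stab M act) (stab_trans M C act) n T
      \<longleftrightarrow> degree_lt C A (Ob M) (stab M act) (stab_trans M C act) n T" for n
    by (intro iffI) (erule degree_lt_generator[OF assms(5,3,6)], erule degree_lt_index_mono)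
  then show ?thesis by (simp add: degree_def)
qed

end
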